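(* For $\gamma=1/2$, the spectral gap $\Lambda$ of the linearized Kac-Boltzmann operator (defined in the context) satisfies $$\Lambda\ \ge\ 0.0263 .$$
   Context: Let $M(v)=\frac1{\sqrt{2\pi}}e^{-v^2/2}$ on $\mathbb R$, and write $v_*=v\cos\theta+w\sin\theta$, $w_*=-v\sin\theta+w\cos\theta$. For $\gamma\ge 0$ the linearized Kac-Boltzmann operator is $$\mathcal Lh(v)=\frac1\pi\int_{\mathbb R}\int_{-\pi}^{\pi}(v^2+w^2)^\gamma\,[h(v_* )+h(w_* )-h(v)-h(w)]\,M(w)\,d\theta\,dw,$$ with quadratic form $$\langle h,\mathcal Lh\rangle=\frac1\pi\int_{\mathbb R}\int_{\mathbb R}\int_{-\pi}^{\pi}(v^2+w^2)^\gamma[h(v)h(v_* )+h(v)h(w_* )-h^2(v)-h(v)h(w)]M(v)M(w)\,d\theta\,dw\,dv .$$ Its spectral gap is $$\Lambda=\inf\left\{-\frac{\langle h,\mathcal Lh\rangle}{\|h\|^2_{L^2(\mathbb R,M\,dv)}}:\ \int_{\mathbb R}h\,M\,dv=\int_{\mathbb R}v^2h\,M\,dv=0\right\},$$ the infimum being over nonzero $h\in L^2(\mathbb R,M\,dv)$ for which the integral defining the quadratic form converges absolutely. *)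

theory Defs
  imports "HOL-Probability.Probability"
begin

abbreviation Maxw :: "real \<Rightarrow> real" where
  "Maxw \<equiv> std_normal_density"

definition post_v :: "real \<Rightarrow> real \<Rightarrow> real \<Rightarrow> real" where
  "post_v v w \<theta> = v * cos \<theta> + w * sin \<theta>"

definition post_w :: "real \<Rightarrow> real \<Rightarrow> real \<Rightarrow> real" where
  "post_w v w \<theta> = - v * sin \<theta> + w * cos \<theta>"

text \<open>The integrand of the triple integral that gives the pairing of \<open>h\<close> with
  \<open>L h\<close> in \<open>L\<^sup>2(M dv)\<close>, where
  \<open>L h (v) = (1/\<pi>) \<integral> \<integral> (v\<^sup>2 + w\<^sup>2)\<^sup>\<gamma> [h(v\<^sub>*) + h(w\<^sub>*) - h(v) - h(w)] M(w) d\<theta> dw\<close>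
  is the linearized Kac-Boltzmann operator. For \<open>\<gamma> = 0\<close> the convention \<open>0 powr 0 = 0\<close>
  only affects the null set \<open>v = w = 0\<close>.\<close>

definition kac_integrand :: "real \<Rightarrow> (real \<Rightarrow> real) \<Rightarrow> real \<Rightarrow> real \<Rightarrow> real \<Rightarrow> real" where
  "kac_integrand \<gamma> h v w \<theta> =
     (v\<^sup>2 + w\<^sup>2) powr \<gamma> *
     (h v * h (post_v v w \<theta>) + h v * h (post_w v w \<theta>) - (h v)\<^sup>2 - h v * h w) *
     Maxw v * Maxw w"

definition kac_dom :: "(real \<times> real \<times> real) set" where
  "kac_dom = UNIV \<times> UNIV \<times> {-pi..pi}"

definition kac_form_converges :: "real \<Rightarrow> (real \<Rightarrow> real) \<Rightarrow> bool" where
  "kac_form_converges \<gamma> h \<longleftrightarrow>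
     set_integrable lborel kac_dom (\<lambda>(v, w, \<theta>). kac_integrand \<gamma> h v w \<theta>)"

text \<open>Only used under \<^const>\<open>kac_form_converges\<close>, where by Fubini the integral over the
  product space equals the iterated integral in \<open>d\<theta> dw dv\<close>.\<close>

definition kac_form :: "real \<Rightarrow> (real \<Rightarrow> real) \<Rightarrow> real" where
  "kac_form \<gamma> h =
     1 / pi * (LINT (v, w, \<theta>) : kac_dom | lborel. kac_integrand \<gamma> h v w \<theta>)"

text \<open>Elements of \<open>L\<^sup>2(M dv)\<close> are represented by Borel functions; since \<open>M > 0\<close>, being
  nonzero in \<open>L\<^sup>2(M dv)\<close> means not vanishing Lebesgue-almost everywhere.\<close>

definition L2M :: "(real \<Rightarrow> real) set" where
  "L2M = {h \<in> borel_measurable borel. integrable lborel (\<lambda>v. (h v)\<^sup>2 * Maxw v)}"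

definition L2M_norm :: "(real \<Rightarrow> real) \<Rightarrow> real" where
  "L2M_norm h = sqrt (LINT v|lborel. (h v)\<^sup>2 * Maxw v)"

definition kac_admissible :: "real \<Rightarrow> (real \<Rightarrow> real) set" where
  "kac_admissible \<gamma> = {h \<in> L2M.
     \<not> (AE v in lborel. h v = 0) \<and>
     kac_form_converges \<gamma> h \<and>
     (LINT v|lborel. h v * Maxw v) = 0 \<and>
     (LINT v|lborel. v\<^sup>2 * h v * Maxw v) = 0}"

text \<open>The infimum is taken in the extended reals, so that it is meaningful without first
  knowing that the quotients are bounded below.\<close>

definition kac_gap :: "real \<Rightarrow> ereal" where
  "kac_gap \<gamma> = (INF h \<in> kac_admissible \<gamma>. ereal (- kac_form \<gamma> h / (L2M_norm h)\<^sup>2))"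

end

theory Submission
  imports Defs
begin

text \<open>Write \<open>H = h(v) + h(w)\<close>, \<open>H\<^sub>* = h(v\<^sub>*) + h(w\<^sub>*)\<close> and \<open>r\<^sup>2 = v\<^sup>2 + w\<^sup>2\<close>. The symmetries of the collision turn
  \<open>- \<langle>h, L h\<rangle>\<close> into half the expectation of \<open>r (H\<^sub>* - H)\<^sup>2\<close> over independent Gaussian \<open>v, w\<close> and a
  uniform angle \<open>\<theta>\<close>.

  Without the weight \<open>r\<close> the gap is at least \<open>1/2\<close>: the correlation of \<open>h(v)\<close> with
  \<open>h(v cos \<theta> + w sin \<theta>)\<close> is at most \<open>cos\<^sup>4 \<theta> \<parallel>h\<parallel>\<^sup>2\<close> for even \<open>h\<close> orthogonal to \<open>1\<close> and \<open>v\<^sup>2\<close>, and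
  \<open>cos\<^sup>4 + sin\<^sup>4\<close> has mean \<open>3/4\<close>. The correlation bound is read off the power series of the Gram matrix of the
  functions \<open>cos (a v)\<close>, whose span is dense among the even functions.

  The weight is restored by \<open>r \<ge> \<epsilon> (1 - \<omega>)\<close> with \<open>\<omega> = max(0, 1 - r/\<epsilon>)\<close>. Because \<open>\<omega>\<close> is radial,
  \<open>E[\<omega> H H\<^sub>*] \<ge> 0\<close>, and therefore \<open>E[\<omega> (H\<^sub>* - H)\<^sup>2] \<le> 2 E[\<omega> H\<^sup>2] \<le> 8 E[max(0, 1 - |w|/\<epsilon>)] \<parallel>h\<parallel>\<^sup>2\<close>, which is
  \<open>O(\<epsilon>)\<close>. The gap is thus at least \<open>\<epsilon> (1/2 - 1.64 \<epsilon>)\<close>, and \<open>\<epsilon> = 0.15\<close> suffices.\<close>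

section \<open>Gaussian correlations of cosines\<close>

text \<open>The obstacle is the weight: r vanishes at the origin, so no positive constant bounds it
  from below, and a gap for the constant weight cannot be transferred directly. Pairs with r <
  \<epsilon> are rare under the Gaussian, and what is lost on them is charged to \<omega>.
  Boundedness of \<omega> matters as well: for h merely in L^2 the integral of r H^2 may diverge, so
  the squared jump of H cannot be expanded against r, but it can be against 1 and against \<omega>.
  Radial symmetry of \<omega> saves a factor of two: discarding a nonnegative correlation costs 2
  E[\<omega> H^2], where the crude bound for a squared difference costs 4 E[\<omega> H^2]. Cosines
  stand in for Hermite polynomials because their Gaussian correlations are elementary. Expanding
  cosh then performs the decomposition by Hermite degree: degree n is damped by c^n, and the even
  degrees 0 and 2 are exactly those that the constraints remove. No constraint controls degree 1;
  odd degrees disappear only through the average over \<theta>. The coefficient 1.64 is 4 times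
  0.41, where 0.41 bounds the peak of the Gaussian density.\<close>

definition gauss :: "real measure" where
  "gauss = std_normal_distribution"

lemma space_gauss [simp]: "space gauss = UNIV"
  and sets_gauss [measurable_cong, simp]: "sets gauss = sets borel"
  by (simp_all add: gauss_def)

interpretation gauss: prob_space gauss
  unfolding gauss_def by (simp add: prob_space_normal_density)

interpretation gauss2: pair_prob_space gauss gauss ..

abbreviation gauss2 :: "(real \<times> real) measure" where
  "gauss2 \<equiv> gauss \<Otimes>\<^sub>M gauss"

text \<open>These are the real and imaginary parts of the characteristic function.\<close>

lemma expectation_cos_gauss: "(LINT x|gauss. cos (a * x)) = exp (- (a\<^sup>2) / 2)"
  and expectation_sin_gauss: "(LINT x|gauss. sin (a * x)) = 0"
proof -
  have i: "complex_integrable gauss (\<lambda>x. iexp (a * x))"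
    by (rule gauss.integrable_const_bound[where B = 1]) auto
  have e: "(CLINT x|gauss. iexp (a * x)) = complex_of_real (exp (- (a\<^sup>2) / 2))"
    using fun_cong[OF char_std_normal_distribution, of a] by (simp add: char_def gauss_def)
  have "(LINT x|gauss. Re (iexp (a * x))) = exp (- (a\<^sup>2) / 2)"
    using e by (subst integral_Re[OF i]) simp
  moreover have "(LINT x|gauss. Im (iexp (a * x))) = 0"
    using e by (subst integral_Im[OF i]) simp
  ultimately show "(LINT x|gauss. cos (a * x)) = exp (- (a\<^sup>2) / 2)"
    "(LINT x|gauss. sin (a * x)) = 0"
    by (simp_all add: Re_exp Im_exp)
qed

lemma expectation_cos_gauss2:
  "(LINT (v, w)|gauss2. cos (a * v + b * w)) = exp (- (a\<^sup>2 + b\<^sup>2) / 2)"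
proof -
  have [simp]: "integrable gauss (\<lambda>x. cos (k * x))" "integrable gauss (\<lambda>x. sin (k * x))" for k
    by (rule gauss.integrable_const_bound[where B = 1]; simp)+
  have "integrable gauss2 (\<lambda>(v, w). cos (a * v + b * w))"
    by (rule gauss2.integrable_const_bound[where B = 1]) (auto simp: split_beta)
  then have "(LINT (v, w)|gauss2. cos (a * v + b * w)) = (LINT v|gauss. (LINT w|gauss. cos (a * v + b * w)))"
    by (subst gauss2.integral_fst'[symmetric]) auto
  also have "\<dots> = exp (- (a\<^sup>2) / 2) * exp (- (b\<^sup>2) / 2)"
    by (simp add: cos_add expectation_cos_gauss expectation_sin_gauss)
  finally show ?thesis by (simp add: exp_add[symmetric] add_divide_distrib)
qed

text \<open>The second argument is a standard normal variable with correlation c to the first.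
  Product-to-sum leaves two cosines whose arguments have variances a^2 + b^2 - 2abc and a^2 + b^2 +
  2abc; the two resulting exponentials average to cosh.\<close>

lemma expectation_cos_cos_gauss2:
  assumes cs: "c\<^sup>2 + s\<^sup>2 = 1"
  shows "(LINT (v, w)|gauss2. cos (a * v) * cos (b * (c * v + s * w))) =
    exp (- (a\<^sup>2) / 2) * exp (- (b\<^sup>2) / 2) * cosh (c * (a * b))"
proof -
  have i: "integrable gauss2 (\<lambda>(v, w). cos (p * v + q * w))" for p q
    by (rule gauss2.integrable_const_bound[where B = 1]) (auto simp: split_beta)
  have *: "cos (a * v) * cos (b * (c * v + s * w)) =
    (cos ((a - b * c) * v + (- b * s) * w) + cos ((a + b * c) * v + (b * s) * w)) / 2" for v w :: real
    by (simp add: cos_times_cos algebra_simps)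
  have s: "s\<^sup>2 = 1 - c\<^sup>2" using cs by simp
  have "(LINT (v, w)|gauss2. cos (a * v) * cos (b * (c * v + s * w))) =
    (exp (- ((a - b * c)\<^sup>2 + (- b * s)\<^sup>2) / 2) + exp (- ((a + b * c)\<^sup>2 + (b * s)\<^sup>2) / 2)) / 2"
    unfolding * using i[of "a - b * c" "- b * s"] i[of "a + b * c" "b * s"]
    unfolding expectation_cos_gauss2[symmetric] split_beta
    by (subst Bochner_Integration.integral_add[symmetric]) simp_all
  also have "- ((a - b * c)\<^sup>2 + (- b * s)\<^sup>2) / 2 = - (a\<^sup>2) / 2 + - (b\<^sup>2) / 2 + c * (a * b)"
    unfolding power_mult_distrib power2_minus s by (simp add: power2_eq_square field_simps)
  also have "- ((a + b * c)\<^sup>2 + (b * s)\<^sup>2) / 2 = - (a\<^sup>2) / 2 + - (b\<^sup>2) / 2 + - (c * (a * b))"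
    unfolding power_mult_distrib power2_minus s by (simp add: power2_eq_square field_simps)
  finally show ?thesis
    unfolding exp_add cosh_def by (simp add: algebra_simps)
qed

lemma integrable_power_gauss [simp]: "integrable gauss (\<lambda>x. x ^ k)"
  unfolding gauss_def by (rule integrable_std_normal_distribution_moment)

lemma expectation_power2_gauss: "(LINT x|gauss. x\<^sup>2) = 1"
  using std_normal_distribution_even_moments(1)[of 1] by (simp add: gauss_def)

lemma expectation_power4_gauss: "(LINT x|gauss. x ^ 4) = 3"
  using std_normal_distribution_even_moments(1)[of 2] by (simp add: gauss_def fact_numeral)


text \<open>By the half-angle formula the left side is 2 sin^2 (x/2). The bound dominates the
  difference quotients taken below.\<close>

lemma one_minus_cos_le: "1 - cos x \<le> x\<^sup>2 / 2" for x :: real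
proof -
  have "\<bar>sin (x / 2)\<bar>\<^sup>2 \<le> \<bar>x / 2\<bar>\<^sup>2"
    by (intro power_mono abs_sin_x_le_abs_x) simp
  then show ?thesis
    using cos_double_sin[of "x / 2"] by (simp add: power2_eq_square)
qed

text \<open>Second order difference quotient at \<open>b = 0\<close> of
  \<open>E[cos (b X) cos (a X)] = exp (- (a\<^sup>2 + b\<^sup>2) / 2) cosh (a b)\<close>.\<close>

lemma expectation_power2_cos_gauss:
  "(LINT x|gauss. x\<^sup>2 * cos (a * x)) = (1 - a\<^sup>2) * exp (- (a\<^sup>2) / 2)"
proof -
  have ic: "integrable gauss (\<lambda>x. cos (k * x))" for k
    by (rule gauss.integrable_const_bound[where B = 1]) auto
  define q where "q b = (LINT x|gauss. 2 * (1 - cos (b * x)) / b\<^sup>2 * cos (a * x))" for b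
  \<comment> \<open>Dominated convergence works along sequences; this one tends to 0 without meeting
    0, so that limits at 0 can be composed with it.\<close>
  have at0: "filterlim (\<lambda>n. inverse (real (Suc n))) (at 0) sequentially"
    unfolding filterlim_at using LIMSEQ_inverse_real_of_nat by simp
  have sin0: "((\<lambda>b. sin (k * b) / b) \<longlongrightarrow> k) (at 0)" for k :: real
  proof -
    have "((\<lambda>b. sin (k * b)) has_field_derivative k) (at 0)"
      by (auto intro!: derivative_eq_intros)
    then show ?thesis by (simp add: DERIV_def)
  qed
  have sinh0: "((\<lambda>b. sinh (k * b) / b) \<longlongrightarrow> k) (at 0)" for k :: real
  proof -
    have "((\<lambda>b. sinh (k * b)) has_field_derivative k) (at 0)"
      by (auto intro!: derivative_eq_intros)
    then show ?thesis by (simp add: DERIV_def)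
  qed
  have "((\<lambda>b. 2 * (1 - cos (b * x)) / b\<^sup>2) \<longlongrightarrow> x\<^sup>2) (at (0::real))" for x :: real
  proof -
    have "((\<lambda>b. 4 * (sin (x / 2 * b) / b)\<^sup>2) \<longlongrightarrow> 4 * (x / 2)\<^sup>2) (at 0)"
      by (intro tendsto_intros sin0)
    moreover have "2 * (1 - cos (b * x)) / b\<^sup>2 = 4 * (sin (x / 2 * b) / b)\<^sup>2" for b
      using cos_double_sin[of "b * x / 2"] by (simp add: power_divide mult.commute)
    moreover have "4 * (x / 2)\<^sup>2 = x\<^sup>2" by (simp add: power_divide)
    ultimately show ?thesis by (simp only:)
  qed
  from filterlim_compose[OF this at0]
  have lim: "(\<lambda>n. 2 * (1 - cos (inverse (real (Suc n)) * x)) / (inverse (real (Suc n)))\<^sup>2) \<longlonglongrightarrow> x\<^sup>2" for x .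
  have bnd: "\<bar>2 * (1 - cos (b * x)) / b\<^sup>2 * cos (a * x)\<bar> \<le> x\<^sup>2" for b x
  \<comment> \<open>At b = 0 the quotient is 0 by the convention for division.\<close>
  proof (cases "b = 0")
    case False
    have "2 * (1 - cos (b * x)) / b\<^sup>2 \<le> x\<^sup>2"
      using one_minus_cos_le[of "b * x"] False by (simp add: field_simps)
    moreover have "0 \<le> 2 * (1 - cos (b * x)) / b\<^sup>2" by simp
    ultimately have "\<bar>2 * (1 - cos (b * x)) / b\<^sup>2\<bar> * \<bar>cos (a * x)\<bar> \<le> x\<^sup>2 * 1"
      by (intro mult_mono) auto
    then show ?thesis by (simp add: abs_mult)
  qed simp
  have "(\<lambda>n. q (inverse (real (Suc n)))) \<longlonglongrightarrow> (LINT x|gauss. x\<^sup>2 * cos (a * x))"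
    unfolding q_def
  proof (rule integral_dominated_convergence[where w = "\<lambda>x. x\<^sup>2"])
    show "AE x in gauss. (\<lambda>n. 2 * (1 - cos (inverse (real (Suc n)) * x)) / (inverse (real (Suc n)))\<^sup>2 * cos (a * x))
      \<longlonglongrightarrow> x\<^sup>2 * cos (a * x)"
      by (intro AE_I2 tendsto_mult lim tendsto_const)
  qed (use bnd in auto)
  moreover have "(\<lambda>n. q (inverse (real (Suc n)))) \<longlonglongrightarrow> (1 - a\<^sup>2) * exp (- (a\<^sup>2) / 2)"
  proof -
    have lq: "q b = exp (- (a\<^sup>2) / 2) * (2 * ((1 - exp (- (b\<^sup>2) / 2)) / b\<^sup>2) - exp (- (b\<^sup>2) / 2) * 4 * (sinh (a / 2 * b) / b)\<^sup>2)" for b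
    proof -
      have "q b = 2 / b\<^sup>2 * (LINT x|gauss. cos (a * x) - cos (b * x) * cos (a * x))"
        unfolding q_def by (subst integral_mult_right_zero[symmetric]) (simp add: algebra_simps diff_divide_distrib)
      also have "(LINT x|gauss. cos (a * x) - cos (b * x) * cos (a * x)) =
        exp (- (a\<^sup>2) / 2) - (exp (- ((b - a)\<^sup>2) / 2) + exp (- ((b + a)\<^sup>2) / 2)) / 2"
      proof -
        have "cos (b * x) * cos (a * x) = (cos ((b - a) * x) + cos ((b + a) * x)) / 2" for x :: real
          by (simp add: cos_times_cos left_diff_distrib distrib_right)
        then show ?thesis
          using ic by (simp only: expectation_cos_gauss Bochner_Integration.integral_diff
              Bochner_Integration.integral_add integral_divide_zero
              Bochner_Integration.integrable_add integrable_divide_zero)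
      qed
      also have "- ((b - a)\<^sup>2) / 2 = - (a\<^sup>2) / 2 + - (b\<^sup>2) / 2 + a * b"
        by (simp add: power2_eq_square field_simps)
      also have "- ((b + a)\<^sup>2) / 2 = - (a\<^sup>2) / 2 + - (b\<^sup>2) / 2 + - (a * b)"
        by (simp add: power2_eq_square field_simps)
      finally have "q b = 2 / b\<^sup>2 * exp (- (a\<^sup>2) / 2) * (1 - exp (- (b\<^sup>2) / 2) * cosh (a * b))"
        unfolding exp_add cosh_def by (simp add: algebra_simps add_divide_distrib)
      \<comment> \<open>This splits off the part of cosh that is of order b^2, so that after
        division by b^2 every factor has an elementary limit.\<close>
      also have "cosh (a * b) = 1 + 2 * (sinh (a / 2 * b))\<^sup>2"
        using cosh_double[of "a * b / 2"] cosh_square_eq[of "a * b / 2"] by simp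
      finally show ?thesis
        by (simp add: power_divide algebra_simps add_divide_distrib diff_divide_distrib)
    qed
    have e0: "((\<lambda>b. (1 - exp (- (b\<^sup>2) / 2)) / b\<^sup>2) \<longlongrightarrow> 1 / 2) (at (0::real))"
    proof -
      have "((\<lambda>x. - exp (- x / 2)) has_field_derivative 1 / 2) (at 0)"
        by (auto intro!: derivative_eq_intros)
      then have "((\<lambda>x. (1 - exp (- x / 2)) / x) \<longlongrightarrow> 1 / 2) (at (0::real))"
        by (simp add: DERIV_def)
      moreover have "filterlim (\<lambda>b. b\<^sup>2) (at 0) (at (0::real))"
        unfolding filterlim_at by (auto intro!: tendsto_eq_intros eventually_at_filter[THEN iffD2])
      ultimately show ?thesis by (rule filterlim_compose)
    qed
    have e1: "((\<lambda>b. exp (- (b\<^sup>2) / 2)) \<longlongrightarrow> exp (- (0\<^sup>2) / 2)) (at (0::real))"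
      by (intro tendsto_intros) simp
    have "((\<lambda>b. exp (- (a\<^sup>2) / 2) * (2 * ((1 - exp (- (b\<^sup>2) / 2)) / b\<^sup>2) - exp (- (b\<^sup>2) / 2) * 4 * (sinh (a / 2 * b) / b)\<^sup>2))
      \<longlongrightarrow> exp (- (a\<^sup>2) / 2) * (2 * (1 / 2) - exp (- (0\<^sup>2) / 2) * 4 * (a / 2)\<^sup>2)) (at 0)"
      by (intro tendsto_mult tendsto_diff tendsto_const e0 e1 sinh0 tendsto_power)
    from filterlim_compose[OF this at0] show ?thesis
      by (simp add: lq power_divide mult.commute)
  qed
  ultimately show ?thesis
    by (rule LIMSEQ_unique)
qed

section \<open>The algebra of cosine polynomials with arbitrary real frequencies\<close>

definition cos_span :: "(real \<Rightarrow> real) set" where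
  "cos_span = {f. \<exists>A c. finite A \<and> f = (\<lambda>x. \<Sum>a\<in>A. c a * cos (a * x))}"

lemma cos_span_single: "(\<lambda>x. k * cos (a * x)) \<in> cos_span"
  unfolding cos_span_def by (intro CollectI exI[of _ "{a}"] exI[of _ "\<lambda>_. k"]) simp

lemma cos_spanE:
  assumes "f \<in> cos_span"
  obtains A c where "finite A" "f = (\<lambda>x. \<Sum>a\<in>A. c a * cos (a * x))"
  using assms unfolding cos_span_def mem_Collect_eq by (elim exE conjE)

lemma cos_span_const: "(\<lambda>x. k) \<in> cos_span"
  using cos_span_single[of k 0] by simp

lemma cos_span_add:
  assumes "f \<in> cos_span" "g \<in> cos_span"
  shows "(\<lambda>x. f x + g x) \<in> cos_span"
proof -
  obtain A c where A: "finite A" "f = (\<lambda>x. \<Sum>a\<in>A. c a * cos (a * x))"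
    using assms(1) by (rule cos_spanE)
  obtain B d where B: "finite B" "g = (\<lambda>x. \<Sum>a\<in>B. d a * cos (a * x))"
    using assms(2) by (rule cos_spanE)
  have "f x = (\<Sum>a\<in>A \<union> B. (if a \<in> A then c a else 0) * cos (a * x))" for x
    unfolding A(2) using A(1) B(1) by (intro sum.mono_neutral_cong_left) auto
  moreover have "g x = (\<Sum>a\<in>A \<union> B. (if a \<in> B then d a else 0) * cos (a * x))" for x
    unfolding B(2) using A(1) B(1) by (intro sum.mono_neutral_cong_left) auto
  ultimately have "(\<lambda>x. f x + g x) =
    (\<lambda>x. \<Sum>a\<in>A \<union> B. ((if a \<in> A then c a else 0) + (if a \<in> B then d a else 0)) * cos (a * x))"
    by (simp add: distrib_right sum.distrib)
  moreover have "finite (A \<union> B)" using A(1) B(1) by simp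
  ultimately show ?thesis
    unfolding cos_span_def by (intro CollectI exI conjI)
qed

lemma cos_span_sum: "(\<And>i. i \<in> I \<Longrightarrow> f i \<in> cos_span) \<Longrightarrow> (\<lambda>x. \<Sum>i\<in>I. f i x) \<in> cos_span"
  by (induction I rule: infinite_finite_induct) (auto intro: cos_span_add cos_span_const)

text \<open>Product-to-sum turns each product into two cosines with frequencies a - b and a + b.
  Closure under products is what Stone-Weierstrass asks for.\<close>

lemma cos_span_mult:
  assumes "f \<in> cos_span" "g \<in> cos_span"
  shows "(\<lambda>x. f x * g x) \<in> cos_span"
proof -
  obtain A c where A: "finite A" "f = (\<lambda>x. \<Sum>a\<in>A. c a * cos (a * x))"
    using assms(1) by (rule cos_spanE)
  obtain B d where B: "finite B" "g = (\<lambda>x. \<Sum>a\<in>B. d a * cos (a * x))"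
    using assms(2) by (rule cos_spanE)
  have "c a * cos (a * x) * (d b * cos (b * x)) =
    c a * d b / 2 * cos ((a - b) * x) + c a * d b / 2 * cos ((a + b) * x)" for a b x
  proof -
    have "c a * cos (a * x) * (d b * cos (b * x)) = c a * d b * (cos (a * x) * cos (b * x))"
      by (simp only: ac_simps)
    then show ?thesis
      unfolding cos_times_cos by (simp add: left_diff_distrib distrib_right distrib_left add_divide_distrib)
  qed
  then have "(\<lambda>x. f x * g x) = (\<lambda>x. \<Sum>a\<in>A. \<Sum>b\<in>B.
    c a * d b / 2 * cos ((a - b) * x) + c a * d b / 2 * cos ((a + b) * x))"
    unfolding A(2) B(2) by (simp add: sum_product)
  moreover have "\<dots> \<in> cos_span"
    by (intro cos_span_sum cos_span_add cos_span_single)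
  ultimately show ?thesis by (simp only:)
qed

lemma cos_span_continuous: "f \<in> cos_span \<Longrightarrow> continuous_on S f"
  unfolding cos_span_def by (auto intro!: continuous_intros)

lemma cos_span_measurable: "f \<in> cos_span \<Longrightarrow> f \<in> borel_measurable borel"
  by (intro borel_measurable_continuous_onI cos_span_continuous)

lemma cos_span_bounded:
  assumes "f \<in> cos_span"
  obtains B where "\<And>x. \<bar>f x\<bar> \<le> B"
proof -
  obtain A c where f: "f = (\<lambda>x. \<Sum>a\<in>A. c a * cos (a * x))"
    using assms by (rule cos_spanE)
  have "\<bar>f x\<bar> \<le> (\<Sum>a\<in>A. \<bar>c a\<bar>)" for x
    unfolding f by (rule order_trans[OF sum_abs]) (auto intro!: sum_mono simp: abs_mult mult_left_le)
  then show ?thesis by (rule that)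
qed

text \<open>After the cosines are rescaled by \<open>exp (a\<^sup>2 / 2)\<close>, their Gram matrix is
  \<open>cosh (c a b) = \<Sum>n even. c\<^sup>n a\<^sup>n b\<^sup>n / n!\<close>, a sum of rank one matrices of which the ones for
  \<open>n = 0\<close> and \<open>n = 2\<close> are seen by the constraints.\<close>

lemma cos_span_correlation_le:
  assumes f: "f \<in> cos_span" and cs: "c\<^sup>2 + s\<^sup>2 = 1"
  shows "(LINT (v, w)|gauss2. f v * f (c * v + s * w)) \<le>
    c ^ 4 * (LINT v|gauss. (f v)\<^sup>2) + (LINT v|gauss. f v)\<^sup>2 +
    (LINT v|gauss. (v\<^sup>2 - 1) * f v)\<^sup>2 / 2"
proof -
  obtain A k where A: "finite A" and fA: "f = (\<lambda>x. \<Sum>a\<in>A. k a * cos (a * x))"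
    using f by (rule cos_spanE)
  \<comment> \<open>\<open>d\<close> absorbs the Gaussian factor of each cosine, \<open>m n\<close>
    is the n-th moment of these coefficients, and \<open>t n\<close> is the contribution of the rank
    one matrix of degree n. Thus \<open>F\<close>, the correlation of f with its rotation, is the
    power series with coefficients \<open>t n\<close>.\<close>
  define d where "d a = k a * exp (- (a\<^sup>2) / 2)" for a
  define m where "m n = (\<Sum>a\<in>A. d a * a ^ n)" for n
  define t where "t n = (if even n then (m n)\<^sup>2 / fact n else 0)" for n
  define F where "F \<rho> = (\<Sum>a\<in>A. \<Sum>b\<in>A. d a * d b * cosh (\<rho> * (a * b)))" for \<rho>
  have ic: "integrable gauss (\<lambda>x. cos (k * x))" for k
    by (rule gauss.integrable_const_bound[where B = 1]) auto
  have ix: "integrable gauss (\<lambda>x. x\<^sup>2 * cos (k * x))" for k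
    by (rule Bochner_Integration.integrable_bound[OF integrable_power_gauss[of 2]])
      (auto simp: abs_mult mult_left_le)
  have F: "(LINT (v, w)|gauss2. f v * f (\<rho> * v + \<sigma> * w)) = F \<rho>" if "\<rho>\<^sup>2 + \<sigma>\<^sup>2 = 1" for \<rho> \<sigma>
  proof -
    have i: "integrable gauss2 (\<lambda>(v, w). cos (a * v) * cos (b * (\<rho> * v + \<sigma> * w)))" for a b
      by (rule gauss2.integrable_const_bound[where B = 1]) (auto simp: split_beta abs_mult mult_le_one)
    have "(LINT (v, w)|gauss2. f v * f (\<rho> * v + \<sigma> * w)) =
      (LINT (v, w)|gauss2. (\<Sum>a\<in>A. \<Sum>b\<in>A. k a * k b * (cos (a * v) * cos (b * (\<rho> * v + \<sigma> * w)))))"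
      unfolding fA sum_product by (simp add: ac_simps)
    also have "\<dots> = (\<Sum>a\<in>A. \<Sum>b\<in>A. k a * k b * (LINT (v, w)|gauss2. cos (a * v) * cos (b * (\<rho> * v + \<sigma> * w))))"
      using i by (simp add: case_prod_unfold)
    finally show ?thesis
      unfolding expectation_cos_cos_gauss2[OF that] F_def d_def by (simp only: ac_simps)
  qed
  have sums: "(\<lambda>n. \<rho> ^ n * t n) sums F \<rho>" for \<rho>
  proof -
    have "(\<lambda>n. \<Sum>a\<in>A. \<Sum>b\<in>A. d a * d b * (if even n then (\<rho> * (a * b)) ^ n /\<^sub>R fact n else 0)) sums F \<rho>"
      unfolding F_def by (intro sums_sum sums_mult cosh_converges)
    moreover have "(\<Sum>a\<in>A. \<Sum>b\<in>A. d a * d b * (if even n then (\<rho> * (a * b)) ^ n /\<^sub>R fact n else 0)) = \<rho> ^ n * t n" for n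
      by (simp add: t_def m_def power2_eq_square sum_product sum_distrib_left sum_divide_distrib
          power_mult_distrib divide_inverse ac_simps)
    ultimately show ?thesis by simp
  qed
  have t0: "t n \<ge> 0" for n by (simp add: t_def)
  have c1: "\<bar>c\<bar> \<le> 1"
    using cs by (metis abs_square_le_1 le_add_same_cancel1 zero_le_power2)
  have F_le: "F c \<le> c ^ 4 * F 1 + (t 0 + c\<^sup>2 * t 2)"
  proof (rule sums_le)
    show "(\<lambda>n. c ^ n * t n) sums F c" by (rule sums)
    have "(\<lambda>n. if n \<in> {0, 2} then c ^ n * t n else 0) sums (\<Sum>n\<in>{0, 2}. c ^ n * t n)"
      by (rule sums_If_finite_set) simp
    then show "(\<lambda>n. c ^ 4 * t n + (if n \<in> {0, 2} then c ^ n * t n else 0)) sums (c ^ 4 * F 1 + (t 0 + c\<^sup>2 * t 2))"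
      using sums[of 1] by (intro sums_add sums_mult) simp_all
    \<comment> \<open>For even n \<ge> 4 the damping c^n is at most c^4; odd terms are zero, and
      degrees 0 and 2 are simply added back.\<close>
    show "c ^ n * t n \<le> c ^ 4 * t n + (if n \<in> {0, 2} then c ^ n * t n else 0)" for n
    proof (cases "even n \<and> n \<notin> {0, 2}")
      case True
      then have "n \<ge> 4" by (auto elim!: evenE)
      then have "\<bar>c\<bar> ^ n \<le> \<bar>c\<bar> ^ 4" using c1 by (intro power_decreasing) auto
      then have "c ^ n \<le> c ^ 4" using True by (simp add: power_even_abs)
      then show ?thesis using True t0 by (auto intro: mult_right_mono)
    next
      case False
      then show ?thesis using t0[of n] by (auto simp: t_def)
    qed
  qed
  have "(LINT v|gauss. f v) = m 0"
    unfolding fA m_def d_def using ic by (simp add: expectation_cos_gauss)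
  then have t_0: "t 0 = (LINT v|gauss. f v)\<^sup>2" by (simp add: t_def)
  \<comment> \<open>Testing against the second Hermite polynomial v^2 - 1 isolates the second
    moment: each cosine contributes -a^2 exp(-a^2/2).\<close>
  have "(LINT v|gauss. (v\<^sup>2 - 1) * f v) = (LINT v|gauss. (\<Sum>a\<in>A. k a * (v\<^sup>2 * cos (a * v) - cos (a * v))))"
    unfolding fA by (simp add: sum_distrib_left algebra_simps sum_subtractf)
  also have "\<dots> = (\<Sum>a\<in>A. k a * ((1 - a\<^sup>2) * exp (- (a\<^sup>2) / 2) - exp (- (a\<^sup>2) / 2)))"
    using ic ix by (simp add: expectation_cos_gauss expectation_power2_cos_gauss)
  also have "\<dots> = - m 2"
    by (simp add: m_def d_def algebra_simps sum_negf[symmetric])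
  finally have t_2: "t 2 = (LINT v|gauss. (v\<^sup>2 - 1) * f v)\<^sup>2 / 2" by (simp add: t_def)
  have F1: "F 1 = (LINT v|gauss. (f v)\<^sup>2)"
  proof -
    from cos_span_bounded[OF f] obtain B where B: "\<And>x. \<bar>f x\<bar> \<le> B" by blast
    have [measurable]: "f \<in> borel_measurable borel" by (rule cos_span_measurable[OF f])
    have "integrable gauss2 (\<lambda>(v, w). f v * f v)"
    proof (rule gauss2.integrable_const_bound[where B = "B * B"])
      show "AE x in gauss2. norm (case x of (v, w) \<Rightarrow> f v * f v) \<le> B * B"
        by (auto simp: abs_mult intro!: AE_I2 mult_mono B order_trans[OF abs_ge_zero B] simp del: abs_mult_self_eq)
    qed simp
    then have "(LINT (v, w)|gauss2. f v * f v) = (LINT v|gauss. (LINT w|gauss. f v * f v))"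
      by (subst gauss2.integral_fst'[symmetric]) auto
    then show ?thesis
      using F[of 1 0] gauss.prob_space by (simp add: power2_eq_square)
  qed
  have "c\<^sup>2 * t 2 \<le> t 2"
    using t0[of 2] c1 by (simp add: mult_left_le_one_le abs_square_le_1)
  then show ?thesis
    using F_le unfolding F[OF cs] F1 t_0 t_2 by linarith
qed

section \<open>Density of the cosines\<close>

text \<open>The cosines of period \<open>2 L\<close> separate the points of \<open>[0, L]\<close>; what Stone-Weierstrass gives on that
  interval is controlled on the whole line because the approximants factor through
  \<open>cos (\<pi> x / L)\<close>.\<close>

lemma cos_span_uniform_approximation:
  fixes g :: "real \<Rightarrow> real"
  assumes cont: "continuous_on UNIV g" and even: "\<And>x. g (- x) = g x" and bnd: "\<And>x. \<bar>g x\<bar> \<le> B"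
    and "0 < L" "0 < e"
  obtains f where "f \<in> cos_span" "\<And>x. \<bar>x\<bar> \<le> L \<Longrightarrow> \<bar>g x - f x\<bar> < e" "\<And>x. \<bar>f x\<bar> \<le> B + e"
proof -
  define P where "P f \<longleftrightarrow> f \<in> cos_span \<and> (\<forall>x y. cos (pi / L * x) = cos (pi / L * y) \<longrightarrow> f x = f y)"
    for f :: "real \<Rightarrow> real"
  have inj: "x = y" if "x \<in> {0..L}" "y \<in> {0..L}" "cos (pi / L * x) = cos (pi / L * y)" for x y
  proof -
    have b: "0 \<le> pi / L * z \<and> pi / L * z \<le> pi" if "z \<in> {0..L}" for z
      using that \<open>0 < L\<close> by (simp add: pos_divide_le_eq)
    have "pi / L * x = pi / L * y"
      using b[OF that(1)] b[OF that(2)] that(3) by (elim conjE) (rule cos_inj_pi)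
    then show ?thesis using \<open>0 < L\<close> by simp
  qed
  have "\<exists>f. P f \<and> (\<forall>x\<in>{0..L}. \<bar>g x - f x\<bar> < e)" (is "\<exists>f. P f \<and> ?Q f")
  proof (rule Stone_Weierstrass_HOL)
    show "\<exists>f. P f \<and> f x \<noteq> f y" if "x \<in> {0..L} \<and> y \<in> {0..L} \<and> x \<noteq> y" for x y
    proof (intro exI conjI)
      show "P (\<lambda>x. cos (pi / L * x))"
        using cos_span_single[of 1 "pi / L"] by (simp add: P_def)
      show "cos (pi / L * x) \<noteq> cos (pi / L * y)" using inj that by blast
    qed
    show "P (\<lambda>x. c)" for c by (simp add: P_def cos_span_const)
    show "P (\<lambda>x. f x + h x)" if "P f \<and> P h" for f h
    proof -
      have *: "f \<in> cos_span" "h \<in> cos_span"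
        "\<And>x y. cos (pi / L * x) = cos (pi / L * y) \<Longrightarrow> f x = f y" "\<And>x y. cos (pi / L * x) = cos (pi / L * y) \<Longrightarrow> h x = h y"
        using that[THEN conjunct1, unfolded P_def, THEN conjunct1] that[THEN conjunct2, unfolded P_def, THEN conjunct1]
          that[THEN conjunct1, unfolded P_def, THEN conjunct2, rule_format]
          that[THEN conjunct2, unfolded P_def, THEN conjunct2, rule_format] by -
      show ?thesis unfolding P_def
        by (intro conjI allI impI cos_span_add *(1,2) arg_cong2[where f = "(+)"]) (erule *(3) *(4))+
    qed
    show "P (\<lambda>x. f x * h x)" if "P f \<and> P h" for f h
    proof -
      have *: "f \<in> cos_span" "h \<in> cos_span"
        "\<And>x y. cos (pi / L * x) = cos (pi / L * y) \<Longrightarrow> f x = f y" "\<And>x y. cos (pi / L * x) = cos (pi / L * y) \<Longrightarrow> h x = h y"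
        using that[THEN conjunct1, unfolded P_def, THEN conjunct1] that[THEN conjunct2, unfolded P_def, THEN conjunct1]
          that[THEN conjunct1, unfolded P_def, THEN conjunct2, rule_format]
          that[THEN conjunct2, unfolded P_def, THEN conjunct2, rule_format] by -
      show ?thesis unfolding P_def
        by (intro conjI allI impI cos_span_mult *(1,2) arg_cong2[where f = "(*)"]) (erule *(3) *(4))+
    qed
    show "continuous_on {0..L} f" if "P f" for f
      using that[unfolded P_def, THEN conjunct1] by (rule cos_span_continuous)
    show "continuous_on {0..L} g" using cont continuous_on_subset by blast
  qed (use \<open>0 < e\<close> in simp_all)
  then obtain f where Pf: "P f" and fe: "\<forall>x\<in>{0..L}. \<bar>g x - f x\<bar> < e"
    by (elim exE conjE) (rule that)
  have f: "f \<in> cos_span" "\<And>x y. cos (pi / L * x) = cos (pi / L * y) \<Longrightarrow> f x = f y"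
    using Pf[unfolded P_def, THEN conjunct1] Pf[unfolded P_def, THEN conjunct2, rule_format] by -
  show thesis
  proof (rule that[OF f(1)])
    fix x
    have "f x = f \<bar>x\<bar>" by (rule f(2)) (auto simp: abs_if)
    moreover have "g x = g \<bar>x\<bar>" using even by (auto simp: abs_if)
    ultimately show "\<bar>g x - f x\<bar> < e" if "\<bar>x\<bar> \<le> L" using bspec[OF fe, of "\<bar>x\<bar>"] that by simp
    \<comment> \<open>y is the point of [0, L] at which x lands when the line is folded up by the
      cosine, so f takes the same value at both.\<close>
    define y where "y = L / pi * arccos (cos (pi / L * x))"
    have "arccos (cos (pi / L * x)) \<le> pi" "0 \<le> arccos (cos (pi / L * x))"
      by (auto intro: arccos_lbound arccos_ubound)
    then have y: "y \<in> {0..L}" using \<open>0 < L\<close> by (simp add: y_def pos_divide_le_eq mult_left_mono)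
    have "f x = f y"
      using \<open>0 < L\<close> by (intro f(2)) (simp add: y_def)
    then show "\<bar>f x\<bar> \<le> B + e" using bspec[OF fe y] bnd[of y] by simp
  qed
qed

section \<open>Closure of the cosine polynomials in the Gaussian L^2 space\<close>

definition cos_closure :: "(real \<Rightarrow> real) set" where
  "cos_closure = {h \<in> borel_measurable borel.
     \<forall>e>0. \<exists>f\<in>cos_span. integrable gauss (\<lambda>x. (h x - f x)\<^sup>2) \<and> (LINT x|gauss. (h x - f x)\<^sup>2) < e}"

lemma cos_closureE:
  assumes "h \<in> cos_closure" "0 < e"
  obtains f where "f \<in> cos_span" "integrable gauss (\<lambda>x. (h x - f x)\<^sup>2)" "(LINT x|gauss. (h x - f x)\<^sup>2) < e"
  using assms unfolding cos_closure_def by blast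

lemma add_power2_le: "(a + b)\<^sup>2 \<le> 2 * a\<^sup>2 + 2 * b\<^sup>2" for a b :: real
  using zero_le_power2[of "a - b"] by (simp add: power2_sum power2_diff)

text \<open>Dominated convergence gives convergence in L^2, and a closure is closed. This is applied
  three times, enlarging the class from cosine polynomials to bounded continuous, bounded
  measurable, and finally square integrable even functions.\<close>

lemma cos_closure_limit:
  assumes g: "\<And>n. g n \<in> cos_closure" and h[measurable]: "h \<in> borel_measurable borel"
    and w: "integrable gauss w" "\<And>n x. (h x - g n x)\<^sup>2 \<le> w x"
    and lim: "AE x in gauss. (\<lambda>n. g n x) \<longlonglongrightarrow> h x"
  shows "h \<in> cos_closure"
  unfolding cos_closure_def
proof (intro CollectI conjI allI impI h)
  fix e :: real assume "0 < e"
  have gm[measurable]: "g n \<in> borel_measurable borel" for n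
    using g[of n] by (simp add: cos_closure_def)
  have hg: "integrable gauss (\<lambda>x. (h x - g n x)\<^sup>2)" for n
    by (rule Bochner_Integration.integrable_bound[OF w(1)])
      (use w(2) in \<open>auto intro: order_trans[OF _ abs_ge_self]\<close>)
  have "(\<lambda>n. LINT x|gauss. (h x - g n x)\<^sup>2) \<longlonglongrightarrow> (LINT x|gauss. 0)"
  proof (rule integral_dominated_convergence[where w = w])
    show "AE x in gauss. (\<lambda>n. (h x - g n x)\<^sup>2) \<longlonglongrightarrow> 0"
      using lim by eventually_elim (auto intro!: tendsto_eq_intros)
  qed (use w in auto)
  \<comment> \<open>The inequality (a + b)^2 \<le> 2 a^2 + 2 b^2 doubles both errors, hence a
    quarter of e for each.\<close>
  then have "eventually (\<lambda>n. (LINT x|gauss. (h x - g n x)\<^sup>2) < e / 4) sequentially"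
    using \<open>0 < e\<close> by (intro order_tendstoD(2)) auto
  then obtain n where n: "(LINT x|gauss. (h x - g n x)\<^sup>2) < e / 4"
    by (auto dest: eventually_happens)
  obtain f where f: "f \<in> cos_span" "integrable gauss (\<lambda>x. (g n x - f x)\<^sup>2)" "(LINT x|gauss. (g n x - f x)\<^sup>2) < e / 4"
    using \<open>0 < e\<close> by (auto intro: cos_closureE[OF g[of n], of "e / 4"])
  have [measurable]: "f \<in> borel_measurable borel" by (rule cos_span_measurable[OF f(1)])
  have le: "(h x - f x)\<^sup>2 \<le> 2 * (h x - g n x)\<^sup>2 + 2 * (g n x - f x)\<^sup>2" for x
    using add_power2_le[of "h x - g n x" "g n x - f x"] by simp
  have i: "integrable gauss (\<lambda>x. 2 * (h x - g n x)\<^sup>2 + 2 * (g n x - f x)\<^sup>2)"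
    using hg f(2) by simp
  have hf: "integrable gauss (\<lambda>x. (h x - f x)\<^sup>2)"
    by (rule Bochner_Integration.integrable_bound[OF i]) (use le in \<open>auto intro: order_trans[OF _ abs_ge_self]\<close>)
  have "(LINT x|gauss. (h x - f x)\<^sup>2) \<le> (LINT x|gauss. 2 * (h x - g n x)\<^sup>2 + 2 * (g n x - f x)\<^sup>2)"
    by (rule integral_mono[OF hf i le])
  also have "\<dots> < e" using n f(3) hg f(2) by simp
  finally show "\<exists>f\<in>cos_span. integrable gauss (\<lambda>x. (h x - f x)\<^sup>2) \<and> (LINT x|gauss. (h x - f x)\<^sup>2) < e"
    using f(1) hf by blast
qed

lemma cos_span_subset_closure: "f \<in> cos_span \<Longrightarrow> f \<in> cos_closure"
  unfolding cos_closure_def by (auto intro!: cos_span_measurable bexI[of _ f])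

lemma bounded_diff_power2_le: "\<bar>a\<bar> \<le> A \<Longrightarrow> \<bar>b\<bar> \<le> B \<Longrightarrow> (a - b)\<^sup>2 \<le> (A + B)\<^sup>2" for a b :: real
  by (intro abs_le_square_iff[THEN iffD1]) auto

text \<open>The period grows with n while the error shrinks, so the approximants converge at every
  point; their common bound B + 1 on the whole line supplies a constant as dominating function,
  integrable because \<open>gauss\<close> is finite.\<close>

lemma cos_closure_continuous:
  fixes g :: "real \<Rightarrow> real"
  assumes cont: "continuous_on UNIV g" and even: "\<And>x. g (- x) = g x" and bnd: "\<And>x. \<bar>g x\<bar> \<le> B"
  shows "g \<in> cos_closure"
proof -
  have "\<exists>f. f \<in> cos_span \<and> (\<forall>x. \<bar>x\<bar> \<le> real (Suc n) \<longrightarrow> \<bar>g x - f x\<bar> < inverse (real (Suc n))) \<and> (\<forall>x. \<bar>f x\<bar> \<le> B + 1)" for n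
  proof -
    obtain f where "f \<in> cos_span" "\<And>x. \<bar>x\<bar> \<le> real (Suc n) \<Longrightarrow> \<bar>g x - f x\<bar> < inverse (real (Suc n))"
      "\<And>x. \<bar>f x\<bar> \<le> B + inverse (real (Suc n))"
      by (rule cos_span_uniform_approximation[OF assms, of "real (Suc n)" "inverse (real (Suc n))"]) auto
    moreover have "inverse (real (Suc n)) \<le> 1" by (simp add: field_simps)
    ultimately show ?thesis by (meson add_left_mono order_trans)
  qed
  then obtain f where f: "\<And>n. f n \<in> cos_span" "\<And>n x. \<bar>x\<bar> \<le> real (Suc n) \<Longrightarrow> \<bar>g x - f n x\<bar> < inverse (real (Suc n))"
    "\<And>n x. \<bar>f n x\<bar> \<le> B + 1"
    by metis
  have "(\<lambda>n. f n x) \<longlonglongrightarrow> g x" for x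
  proof -
    have "(\<lambda>n. g x - f n x) \<longlonglongrightarrow> 0"
    proof (rule Lim_null_comparison)
      have "eventually (\<lambda>n. \<bar>x\<bar> \<le> real n) sequentially"
        using eventually_ge_at_top[of "nat \<lceil>\<bar>x\<bar>\<rceil>"] by eventually_elim linarith
      then show "\<forall>\<^sub>F n in sequentially. norm (g x - f n x) \<le> inverse (real (Suc n))"
        by eventually_elim (use f(2)[of x] in \<open>force intro: less_imp_le\<close>)
    qed (rule LIMSEQ_inverse_real_of_nat)
    from tendsto_diff[OF tendsto_const[of "g x"] this] show ?thesis by simp
  qed
  then have lim: "AE x in gauss. (\<lambda>n. f n x) \<longlonglongrightarrow> g x" by simp
  show ?thesis
  proof (rule cos_closure_limit[where w = "\<lambda>_. (B + (B + 1))\<^sup>2", OF _ _ _ _ lim])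
    show "f n \<in> cos_closure" for n by (rule cos_span_subset_closure[OF f(1)])
    show "(g x - f n x)\<^sup>2 \<le> (B + (B + 1))\<^sup>2" for n x by (rule bounded_diff_power2_le[OF bnd f(3)])
  qed (auto intro: borel_measurable_continuous_onI cont)
qed

lemma AE_gauss: "AE x in lborel. P x \<Longrightarrow> AE x in gauss. P x"
  unfolding gauss_def by (subst AE_density) auto

text \<open>A measurable function is an almost everywhere limit of continuous ones. Those are made
  even by averaging with their reflection, which is why the exceptional set is enlarged by its
  mirror image, and are clamped to [-B, B] to be uniformly bounded.\<close>

lemma cos_closure_bounded:
  fixes h :: "real \<Rightarrow> real"
  assumes [measurable]: "h \<in> borel_measurable borel" and even: "\<And>x. h (- x) = h x" and bnd: "\<And>x. \<bar>h x\<bar> \<le> B"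
  shows "h \<in> cos_closure"
proof -
  have "h measurable_on UNIV"
    by (rule lebesgue_measurable_imp_measurable_on_real) (auto intro: measurable_completion)
  then obtain N g where N: "negligible N" and g: "\<And>n. continuous_on UNIV (g n)" "\<And>x. x \<notin> N \<Longrightarrow> (\<lambda>n. g n x) \<longlonglongrightarrow> h x"
    unfolding measurable_on_def by auto
  have "negligible (uminus ` N)"
    by (rule negligible_locally_Lipschitz_image[OF order_refl N])
      (rule exI[of _ UNIV], rule exI[of _ 1], simp add: abs_minus_commute)
  then have "negligible (N \<union> uminus ` N)" using N by simp
  then have AE: "AE x in lborel. x \<notin> N \<union> uminus ` N"
    unfolding negligible_iff_null_sets by (rule AE_completion_iff[THEN iffD1, OF AE_not_in])
  define k where "k n x = max (- B) (min B ((g n x + g n (- x)) / 2))" for n x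
  have B: "0 \<le> B" using bnd[of 0] by simp
  show ?thesis
  proof (rule cos_closure_limit[where g = k and w = "\<lambda>_. (B + B)\<^sup>2"])
    have cm: "continuous_on UNIV (\<lambda>x. g n (- x))" for n
      by (rule continuous_on_compose2[OF g(1)[of n]]) (auto intro: continuous_intros)
    have kB: "\<bar>k n x\<bar> \<le> B" for n x using B by (auto simp: k_def)
    show "k n \<in> cos_closure" for n
      by (rule cos_closure_continuous[where B = B])
        (auto simp: k_def add.commute intro!: continuous_intros g cm kB[unfolded k_def])
    show "(h x - k n x)\<^sup>2 \<le> (B + B)\<^sup>2" for n x
      by (intro bounded_diff_power2_le bnd kB)
    show "AE x in gauss. (\<lambda>n. k n x) \<longlonglongrightarrow> h x"
    proof (rule AE_gauss, rule AE_mp[OF AE], rule AE_I2, rule impI)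
      fix x assume "x \<notin> N \<union> uminus ` N"
      then have "x \<notin> N" "- x \<notin> N" by (auto simp: image_iff)
      then have "(\<lambda>n. k n x) \<longlonglongrightarrow> max (- B) (min B ((h x + h (- x)) / 2))"
        unfolding k_def by (intro tendsto_intros g) auto
      also have "max (- B) (min B ((h x + h (- x)) / 2)) = h x"
        using bnd[of x] even[of x] by auto
      finally show "(\<lambda>n. k n x) \<longlonglongrightarrow> h x" .
    qed
  qed auto
qed

text \<open>Truncation at height n keeps h even, and the squared error is dominated by h^2
  itself.\<close>

lemma even_L2_in_cos_closure:
  fixes h :: "real \<Rightarrow> real"
  assumes [measurable]: "h \<in> borel_measurable borel" and even: "\<And>x. h (- x) = h x"
    and sq: "integrable gauss (\<lambda>x. (h x)\<^sup>2)"
  shows "h \<in> cos_closure"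
proof (rule cos_closure_limit[where g = "\<lambda>n x. max (- real n) (min (real n) (h x))" and w = "\<lambda>x. (h x)\<^sup>2"])
  show "(\<lambda>x. max (- real n) (min (real n) (h x))) \<in> cos_closure" for n
    by (rule cos_closure_bounded[where B = "real n"]) (auto simp: even)
  show "(h x - max (- real n) (min (real n) (h x)))\<^sup>2 \<le> (h x)\<^sup>2" for n x
    by (intro abs_le_square_iff[THEN iffD1]) auto
  have "(\<lambda>n. max (- real n) (min (real n) (h x))) \<longlonglongrightarrow> h x" for x
  proof (rule tendsto_eventually)
    show "\<forall>\<^sub>F n in sequentially. max (- real n) (min (real n) (h x)) = h x"
      using eventually_ge_at_top[of "nat \<lceil>\<bar>h x\<bar>\<rceil>"] by eventually_elim linarith
  qed
  then show "AE x in gauss. (\<lambda>n. max (- real n) (min (real n) (h x))) \<longlonglongrightarrow> h x" by simp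
qed (use sq in auto)

section \<open>Rotation invariance\<close>

text \<open>A rotation other than the half turn is a product of three shears.\<close>

lemma nn_integral_shear_fst:
  fixes f :: "real \<times> real \<Rightarrow> ennreal"
  assumes [measurable]: "f \<in> borel_measurable borel"
  shows "(\<integral>\<^sup>+p. f (fst p + t * snd p, snd p) \<partial>(lborel \<Otimes>\<^sub>M lborel)) = (\<integral>\<^sup>+p. f p \<partial>(lborel \<Otimes>\<^sub>M lborel))"
proof -
  have [measurable]: "f \<in> borel_measurable (lborel \<Otimes>\<^sub>M lborel)"
    by (simp add: borel_prod measurable_lborel1 lborel_prod)
  have "(\<integral>\<^sup>+p. f (fst p + t * snd p, snd p) \<partial>(lborel \<Otimes>\<^sub>M lborel)) =
    (\<integral>\<^sup>+w. \<integral>\<^sup>+v. f (v + t * w, w) \<partial>lborel \<partial>lborel)"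
    by (subst lborel_pair.nn_integral_snd[symmetric]) simp_all
  also have "\<dots> = (\<integral>\<^sup>+w. \<integral>\<^sup>+v. f (v, w) \<partial>lborel \<partial>lborel)"
  proof (rule nn_integral_cong)
    fix w :: real
    have "(\<integral>\<^sup>+v. f (v, w) \<partial>lborel) = (\<integral>\<^sup>+v. f (t * w + 1 * v, w) \<partial>lborel)"
      by (subst nn_integral_real_affine[where c = 1 and t = "t * w"]) simp_all
    then show "(\<integral>\<^sup>+v. f (v + t * w, w) \<partial>lborel) = (\<integral>\<^sup>+v. f (v, w) \<partial>lborel)"
      by (simp add: add.commute)
  qed
  also have "\<dots> = (\<integral>\<^sup>+p. f p \<partial>(lborel \<Otimes>\<^sub>M lborel))"
    by (subst lborel_pair.nn_integral_snd) simp_all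
  finally show ?thesis .
qed

lemma nn_integral_shear_snd:
  fixes f :: "real \<times> real \<Rightarrow> ennreal"
  assumes [measurable]: "f \<in> borel_measurable borel"
  shows "(\<integral>\<^sup>+p. f (fst p, snd p + t * fst p) \<partial>(lborel \<Otimes>\<^sub>M lborel)) = (\<integral>\<^sup>+p. f p \<partial>(lborel \<Otimes>\<^sub>M lborel))"
proof -
  have [measurable]: "f \<in> borel_measurable (lborel \<Otimes>\<^sub>M lborel)"
    by (simp add: borel_prod measurable_lborel1 lborel_prod)
  have "(\<integral>\<^sup>+p. f (fst p, snd p + t * fst p) \<partial>(lborel \<Otimes>\<^sub>M lborel)) =
    (\<integral>\<^sup>+v. \<integral>\<^sup>+w. f (v, w + t * v) \<partial>lborel \<partial>lborel)"
    by (subst lborel.nn_integral_fst[symmetric]) simp_all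
  also have "\<dots> = (\<integral>\<^sup>+v. \<integral>\<^sup>+w. f (v, w) \<partial>lborel \<partial>lborel)"
  proof (rule nn_integral_cong)
    fix v :: real
    have "(\<integral>\<^sup>+w. f (v, w) \<partial>lborel) = (\<integral>\<^sup>+w. f (v, t * v + 1 * w) \<partial>lborel)"
      by (subst nn_integral_real_affine[where c = 1 and t = "t * v"]) simp_all
    then show "(\<integral>\<^sup>+w. f (v, w + t * v) \<partial>lborel) = (\<integral>\<^sup>+w. f (v, w) \<partial>lborel)"
      by (simp add: add.commute)
  qed
  also have "\<dots> = (\<integral>\<^sup>+p. f p \<partial>(lborel \<Otimes>\<^sub>M lborel))"
    by (subst lborel.nn_integral_fst) simp_all
  finally show ?thesis .
qed

section \<open>Rotations of the plane and of the Gaussian pair\<close>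

definition rot :: "real \<Rightarrow> real \<Rightarrow> real \<times> real \<Rightarrow> real \<times> real" where
  "rot c s p = (c * fst p + s * snd p, - s * fst p + c * snd p)"

lemma fst_rot [simp]: "fst (rot c s p) = c * fst p + s * snd p"
  and snd_rot [simp]: "snd (rot c s p) = - s * fst p + c * snd p"
  by (simp_all add: rot_def)

lemma rot_measurable [measurable]: "rot c s \<in> borel_measurable borel"
  unfolding rot_def by (intro borel_measurable_continuous_onI continuous_intros)

lemma nn_integral_rot_lborel:
  fixes f :: "real \<times> real \<Rightarrow> ennreal"
  assumes f[measurable]: "f \<in> borel_measurable borel" and cs: "c\<^sup>2 + s\<^sup>2 = 1"
  shows "(\<integral>\<^sup>+p. f (rot c s p) \<partial>(lborel \<Otimes>\<^sub>M lborel)) = (\<integral>\<^sup>+p. f p \<partial>(lborel \<Otimes>\<^sub>M lborel))"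
proof -
  have *: "(\<integral>\<^sup>+p. g (rot c s p) \<partial>(lborel \<Otimes>\<^sub>M lborel)) = (\<integral>\<^sup>+p. g p \<partial>(lborel \<Otimes>\<^sub>M lborel))"
    if cs: "c\<^sup>2 + s\<^sup>2 = 1" and c: "c \<noteq> -1" and g[measurable]: "g \<in> borel_measurable borel"
    for c s :: real and g :: "real \<times> real \<Rightarrow> ennreal"
  proof -
    \<comment> \<open>This is the tangent of half the angle, defined for every rotation but the half
      turn.\<close>
    define t where "t = s / (1 + c)"
    define S1 where "S1 p = (fst p + t * snd p, snd p)" for p :: "real \<times> real"
    define S2 where "S2 p = (fst p, snd p + (- s) * fst p)" for p :: "real \<times> real"
    have "1 + c \<noteq> 0" using c by linarith
    moreover have "s * s = (1 - c) * (1 + c)" using cs by (simp add: power2_eq_square algebra_simps)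
    ultimately have ts: "t * s = 1 - c" "t * (1 + c) = s" by (simp_all add: t_def)
    have rot: "rot c s p = S1 (S2 (S1 p))" for p
    proof (rule prod_eqI)
      have "fst (S1 (S2 (S1 p))) = (1 - t * s) * fst p + (t + t * (1 - t * s)) * snd p"
        by (simp add: S1_def S2_def algebra_simps)
      also have "t + t * (1 - t * s) = s" using ts(2) unfolding ts(1) by (simp add: distrib_left)
      finally show "fst (rot c s p) = fst (S1 (S2 (S1 p)))" using ts by simp
      have "snd (S1 (S2 (S1 p))) = - s * fst p + (1 - t * s) * snd p"
        by (simp add: S1_def S2_def algebra_simps)
      then show "snd (rot c s p) = snd (S1 (S2 (S1 p)))" using ts by simp
    qed
    have [measurable]: "S1 \<in> borel_measurable borel" "S2 \<in> borel_measurable borel"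
      unfolding S1_def S2_def by (intro borel_measurable_continuous_onI continuous_intros)+
    have "(\<integral>\<^sup>+p. g (S1 (S2 (S1 p))) \<partial>(lborel \<Otimes>\<^sub>M lborel)) = (\<integral>\<^sup>+p. g (S1 (S2 p)) \<partial>(lborel \<Otimes>\<^sub>M lborel))"
      by (rule nn_integral_shear_fst[of "\<lambda>p. g (S1 (S2 p))" t, folded S1_def]) simp
    also have "\<dots> = (\<integral>\<^sup>+p. g (S1 p) \<partial>(lborel \<Otimes>\<^sub>M lborel))"
      by (rule nn_integral_shear_snd[of "\<lambda>p. g (S1 p)" "- s", folded S2_def]) simp
    also have "\<dots> = (\<integral>\<^sup>+p. g p \<partial>(lborel \<Otimes>\<^sub>M lborel))"
      by (rule nn_integral_shear_fst[of g t, folded S1_def]) simp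
    finally show ?thesis unfolding rot .
  qed
  show ?thesis
  proof (cases "c = -1")
    case True
    then have "s = 0" using cs by simp
    \<comment> \<open>The half turn is two quarter turns, to each of which the shear argument
      applies.\<close>
    then have "rot c s p = rot 0 1 (rot 0 1 p)" for p
      using True by (simp add: rot_def)
    then show ?thesis
      using *[of 0 1 "\<lambda>p. f (rot 0 1 p)"] *[of 0 1 f] by simp
  qed (rule *[OF cs _ f])
qed

lemma gauss2_eq_density:
  "gauss2 = density (lborel \<Otimes>\<^sub>M lborel) (\<lambda>p. ennreal (exp (- ((fst p)\<^sup>2 + (snd p)\<^sup>2) / 2) / (2 * pi)))"
proof -
  have "gauss2 = density (lborel \<Otimes>\<^sub>M lborel)
    (\<lambda>(v, w). ennreal (std_normal_density v) * ennreal (std_normal_density w))"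
    unfolding gauss_def
    by (intro pair_measure_density lborel.sigma_finite_measure_axioms
        prob_space_imp_sigma_finite prob_space_normal_density) simp_all
  moreover have "ennreal (std_normal_density v) * ennreal (std_normal_density w) =
    ennreal (exp (- (v\<^sup>2 + w\<^sup>2) / 2) / (2 * pi))" for v w
    unfolding ennreal_mult[OF normal_density_nonneg normal_density_nonneg, symmetric]
    by (simp add: std_normal_density_def exp_add[symmetric] field_simps)
  ultimately show ?thesis by (simp add: case_prod_unfold)
qed

lemma rot_norm: "c\<^sup>2 + s\<^sup>2 = 1 \<Longrightarrow> (fst (rot c s p))\<^sup>2 + (snd (rot c s p))\<^sup>2 = (fst p)\<^sup>2 + (snd p)\<^sup>2"
proof -
  assume cs: "c\<^sup>2 + s\<^sup>2 = 1"
  have "(fst (rot c s p))\<^sup>2 + (snd (rot c s p))\<^sup>2 = (c\<^sup>2 + s\<^sup>2) * ((fst p)\<^sup>2 + (snd p)\<^sup>2)"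
    by (simp add: power2_eq_square algebra_simps)
  then show ?thesis by (simp add: cs)
qed

text \<open>The density of the Gaussian pair depends only on the norm, so the invariance of Lebesgue
  measure carries over.\<close>

lemma nn_integral_rot_gauss2:
  fixes f :: "real \<times> real \<Rightarrow> ennreal"
  assumes f: "f \<in> borel_measurable borel" and cs: "c\<^sup>2 + s\<^sup>2 = 1"
  shows "(\<integral>\<^sup>+p. f (rot c s p) \<partial>gauss2) = (\<integral>\<^sup>+p. f p \<partial>gauss2)"
proof -
  define d where "d p = ennreal (exp (- ((fst p)\<^sup>2 + (snd p)\<^sup>2) / 2) / (2 * pi))" for p :: "real \<times> real"
  have d[measurable]: "d \<in> borel_measurable borel"
    unfolding d_def by (intro measurable_compose[OF _ measurable_ennreal] borel_measurable_continuous_onI continuous_intros) simp_all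
  have [measurable]: "d \<in> borel_measurable (lborel \<Otimes>\<^sub>M lborel)" "f \<in> borel_measurable (lborel \<Otimes>\<^sub>M lborel)"
    "(\<lambda>p. f (rot c s p)) \<in> borel_measurable (lborel \<Otimes>\<^sub>M lborel)"
    using f d measurable_compose[OF rot_measurable f] by (simp_all add: borel_prod measurable_lborel1 lborel_prod)
  have g: "gauss2 = density (lborel \<Otimes>\<^sub>M lborel) d"
    unfolding d_def by (rule gauss2_eq_density)
  have "(\<integral>\<^sup>+p. f (rot c s p) \<partial>gauss2) = (\<integral>\<^sup>+p. d (rot c s p) * f (rot c s p) \<partial>(lborel \<Otimes>\<^sub>M lborel))"
    unfolding g by (subst nn_integral_density) (simp_all add: d_def rot_norm[OF cs] del: fst_rot snd_rot)
  also have "\<dots> = (\<integral>\<^sup>+p. d p * f p \<partial>(lborel \<Otimes>\<^sub>M lborel))"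
    using f d by (intro nn_integral_rot_lborel[of "\<lambda>p. d p * f p"] cs) simp
  also have "\<dots> = (\<integral>\<^sup>+p. f p \<partial>gauss2)"
    unfolding g by (subst nn_integral_density) simp_all
  finally show ?thesis .
qed

lemma sets_gauss2 [measurable_cong, simp]: "sets gauss2 = sets borel"
  by (simp add: borel_prod[symmetric] cong: sets_pair_measure_cong)

lemma distr_rot_gauss2:
  assumes cs: "c\<^sup>2 + s\<^sup>2 = 1"
  shows "distr gauss2 gauss2 (rot c s) = gauss2"
proof (rule measure_eqI)
  have m: "rot c s \<in> measurable gauss2 gauss2"
    unfolding measurable_cong_sets[OF sets_gauss2 sets_gauss2] by (rule rot_measurable)
  fix A assume "A \<in> sets (distr gauss2 gauss2 (rot c s))"
  then have A[measurable]: "A \<in> sets borel" unfolding sets_distr sets_gauss2 .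
  have "emeasure (distr gauss2 gauss2 (rot c s)) A = (\<integral>\<^sup>+p. indicator A p \<partial>distr gauss2 gauss2 (rot c s))"
    by (rule nn_integral_indicator[symmetric]) (unfold sets_distr sets_gauss2, rule A)
  also have "\<dots> = (\<integral>\<^sup>+p. indicator A (rot c s p) \<partial>gauss2)"
    by (subst nn_integral_distr[OF m]) simp_all
  also have "\<dots> = (\<integral>\<^sup>+p. indicator A p \<partial>gauss2)"
    by (rule nn_integral_rot_gauss2[OF _ cs]) simp
  also have "\<dots> = emeasure gauss2 A"
    by (rule nn_integral_indicator) (unfold sets_gauss2, rule A)
  finally show "emeasure (distr gauss2 gauss2 (rot c s)) A = emeasure gauss2 A" .
qed simp

lemma integrable_rot_gauss2_iff:
  fixes f :: "real \<times> real \<Rightarrow> real"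
  assumes "f \<in> borel_measurable borel" "c\<^sup>2 + s\<^sup>2 = 1"
  shows "integrable gauss2 (\<lambda>p. f (rot c s p)) \<longleftrightarrow> integrable gauss2 f"
  using integrable_distr_eq[of "rot c s" gauss2 gauss2 f] distr_rot_gauss2[OF assms(2)] assms(1)
  by simp

lemma integral_rot_gauss2:
  fixes f :: "real \<times> real \<Rightarrow> real"
  assumes "f \<in> borel_measurable borel" "c\<^sup>2 + s\<^sup>2 = 1"
  shows "(LINT p|gauss2. f (rot c s p)) = (LINT p|gauss2. f p)"
  using integral_distr[of "rot c s" gauss2 gauss2 f] distr_rot_gauss2[OF assms(2)] assms(1)
  by simp

section \<open>Correlation of even functions\<close>

lemma integral_fst_gauss2:
  fixes f :: "real \<Rightarrow> real"
  assumes [measurable]: "f \<in> borel_measurable borel"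
  shows "(LINT p|gauss2. f (fst p)) = (LINT x|gauss. f x)"
    and "integrable gauss2 (\<lambda>p. f (fst p)) \<longleftrightarrow> integrable gauss f"
proof -
  have d: "distr gauss2 gauss fst = gauss" by (rule gauss.distr_pair_fst)
  show "(LINT p|gauss2. f (fst p)) = (LINT x|gauss. f x)"
    using integral_distr[of fst gauss2 gauss f] d by simp
  show "integrable gauss2 (\<lambda>p. f (fst p)) \<longleftrightarrow> integrable gauss f"
    using integrable_distr_eq[of fst gauss2 gauss f] d by simp
qed

lemma measurable_fst_gauss2: "f \<in> borel_measurable borel \<Longrightarrow> (\<lambda>p. f (fst p)) \<in> borel_measurable gauss2"
  by (rule measurable_compose[OF measurable_fst]) simp

text \<open>The linear combination is the first coordinate of the rotated pair, hence again standard
  normal.\<close>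

lemma integral_lin_gauss2:
  fixes f :: "real \<Rightarrow> real"
  assumes f: "f \<in> borel_measurable borel" and cs: "c\<^sup>2 + s\<^sup>2 = 1"
  shows "(LINT p|gauss2. f (c * fst p + s * snd p)) = (LINT x|gauss. f x)"
    and "integrable gauss2 (\<lambda>p. f (c * fst p + s * snd p)) \<longleftrightarrow> integrable gauss f"
proof -
  have m: "(\<lambda>p::real \<times> real. f (fst p)) \<in> borel_measurable borel"
    by (rule measurable_compose[OF _ f]) (simp add: borel_prod[symmetric])
  show "(LINT p|gauss2. f (c * fst p + s * snd p)) = (LINT x|gauss. f x)"
    using integral_rot_gauss2[OF m cs] integral_fst_gauss2(1)[OF f] by simp
  show "integrable gauss2 (\<lambda>p. f (c * fst p + s * snd p)) \<longleftrightarrow> integrable gauss f"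
    using integrable_rot_gauss2_iff[OF m cs] integral_fst_gauss2(2)[OF f] by simp
qed

lemma integrable_mult_L2:
  fixes f g :: "'a \<Rightarrow> real"
  assumes "f \<in> borel_measurable M" "g \<in> borel_measurable M"
    and "integrable M (\<lambda>x. (f x)\<^sup>2)" "integrable M (\<lambda>x. (g x)\<^sup>2)"
  shows "integrable M (\<lambda>x. f x * g x)"
proof (rule Bochner_Integration.integrable_bound[OF Bochner_Integration.integrable_add[OF assms(3,4)]])
  show "AE x in M. norm (f x * g x) \<le> norm ((f x)\<^sup>2 + (g x)\<^sup>2)"
  proof (rule AE_I2)
    fix x
    have "2 * (\<bar>f x\<bar> * \<bar>g x\<bar>) \<le> (f x)\<^sup>2 + (g x)\<^sup>2"
      using sum_squares_bound[of "\<bar>f x\<bar>" "\<bar>g x\<bar>"] by (simp add: mult.assoc)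
    moreover have "0 \<le> \<bar>f x\<bar> * \<bar>g x\<bar>" by simp
    ultimately show "norm (f x * g x) \<le> norm ((f x)\<^sup>2 + (g x)\<^sup>2)" 
      unfolding real_norm_def abs_mult by linarith
  qed
qed (use assms in simp)

text \<open>Young's inequality with a free weight t plays the role of Cauchy-Schwarz: no square
  roots appear, and if one factor has squared norm at most t^2, both sides of the balance are linear
  in t.\<close>

lemma abs_integral_mult_le:
  fixes f g :: "'a \<Rightarrow> real"
  assumes "f \<in> borel_measurable M" "g \<in> borel_measurable M"
    and "integrable M (\<lambda>x. (f x)\<^sup>2)" "integrable M (\<lambda>x. (g x)\<^sup>2)" and "0 < t"
  shows "2 * \<bar>LINT x|M. f x * g x\<bar> \<le> t * (LINT x|M. (f x)\<^sup>2) + (LINT x|M. (g x)\<^sup>2) / t"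
proof -
  have i: "integrable M (\<lambda>x. f x * g x)" by (rule integrable_mult_L2[OF assms(1-4)])
  have p: "2 * \<bar>f x * g x\<bar> \<le> t * (f x)\<^sup>2 + (g x)\<^sup>2 / t" for x
  proof -
    have "0 \<le> (t * \<bar>f x\<bar> - \<bar>g x\<bar>)\<^sup>2 / t" using \<open>0 < t\<close> by simp
    also have "\<dots> = t * (f x)\<^sup>2 + (g x)\<^sup>2 / t - 2 * \<bar>f x * g x\<bar>"
      using \<open>0 < t\<close> by (simp add: power2_diff power_mult_distrib abs_mult field_simps power2_eq_square)
    finally show ?thesis by simp
  qed
  have "2 * \<bar>LINT x|M. f x * g x\<bar> \<le> 2 * (LINT x|M. \<bar>f x * g x\<bar>)"
    by (intro mult_left_mono integral_abs_bound) simp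
  also have "\<dots> = (LINT x|M. 2 * \<bar>f x * g x\<bar>)" by simp
  also have "\<dots> \<le> (LINT x|M. t * (f x)\<^sup>2 + (g x)\<^sup>2 / t)"
    using i assms(3,4) by (intro integral_mono p) simp_all
  also have "\<dots> = t * (LINT x|M. (f x)\<^sup>2) + (LINT x|M. (g x)\<^sup>2) / t"
    using assms(3,4) by simp
  finally show ?thesis .
qed

text \<open>An approximating cosine polynomial f may violate the two constraints. Its inner products
  with 1 and v^2 - 1 are, up to sign, those of h - f, so the two extra terms in
  \<open>cos_span_correlation_le\<close> vanish in the limit together with the other errors.\<close>

lemma even_correlation_le:
  fixes h :: "real \<Rightarrow> real"
  assumes hm[measurable]: "h \<in> borel_measurable borel" and even: "\<And>x. h (- x) = h x"
    and sq: "integrable gauss (\<lambda>x. (h x)\<^sup>2)"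
    and h0: "(LINT x|gauss. h x) = 0" and h2: "(LINT x|gauss. x\<^sup>2 * h x) = 0"
    and cs: "c\<^sup>2 + s\<^sup>2 = 1"
  shows "(LINT p|gauss2. h (fst p) * h (c * fst p + s * snd p)) \<le> c ^ 4 * (LINT x|gauss. (h x)\<^sup>2)"
proof -
  define S where "S = (LINT x|gauss. (h x)\<^sup>2)"
  have S: "0 \<le> S" by (simp add: S_def)
  have cs4: "0 \<le> c ^ 4 \<and> c ^ 4 \<le> 1"
    using cs power_le_one[of "c\<^sup>2" 2] by (simp add: le_add_same_cancel1 flip: power_mult) (metis le_add_same_cancel1 zero_le_power2)
  have one: "integrable gauss (\<lambda>x. (1::real)\<^sup>2)" and He: "integrable gauss (\<lambda>x. (x\<^sup>2 - 1)\<^sup>2 :: real)"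
    by (simp_all add: power2_diff flip: power_mult)
  have intHe: "(LINT x|gauss. (x\<^sup>2 - 1)\<^sup>2 :: real) = 2"
    by (simp add: power2_diff expectation_power4_gauss expectation_power2_gauss gauss.prob_space[simplified] flip: power_mult)
  have ih: "integrable gauss h"
    using integrable_mult_L2[OF _ _ sq one] by simp
  have ih2: "integrable gauss (\<lambda>x. x\<^sup>2 * h x)"
    using integrable_mult_L2[of "\<lambda>x. x\<^sup>2" gauss h] sq by (simp flip: power_mult)
  \<comment> \<open>The approximant is chosen within t^2 in squared norm, so that E / t \<le> t and
    Young's inequality with weight t makes every error linear in t.\<close>
  have key: "(LINT p|gauss2. h (fst p) * h (c * fst p + s * snd p)) \<le> c ^ 4 * S + (S + 1) * (12 * t)"
    if t: "0 < t" "t \<le> 1" for t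
  proof -
    have "h \<in> cos_closure" by (rule even_L2_in_cos_closure[OF hm even sq])
    then obtain f where f: "f \<in> cos_span" and e2: "integrable gauss (\<lambda>x. (h x - f x)\<^sup>2)"
      and small: "(LINT x|gauss. (h x - f x)\<^sup>2) < t\<^sup>2"
      by (rule cos_closureE[of h "t\<^sup>2"]) (use t in auto)
    define e where "e x = h x - f x" for x
    define E where "E = (LINT x|gauss. (e x)\<^sup>2)"
    have E: "0 \<le> E" "E \<le> t\<^sup>2" using small by (auto simp: E_def e_def)
    have t2: "t\<^sup>2 \<le> t" using t by (simp add: power2_eq_square mult_left_le)
    have Et: "E / t \<le> t" using E(2) t by (simp add: field_simps power2_eq_square)
    have fm[measurable]: "f \<in> borel_measurable borel" by (rule cos_span_measurable[OF f])
    have em[measurable]: "e \<in> borel_measurable borel" unfolding e_def by simp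
    have ie: "integrable gauss (\<lambda>x. (e x)\<^sup>2)" using e2 by (simp add: e_def)
    have if2: "integrable gauss (\<lambda>x. (f x)\<^sup>2)"
    proof -
      obtain B where B: "\<And>x. \<bar>f x\<bar> \<le> B" using cos_span_bounded[OF f] by blast
      show ?thesis
        by (rule gauss.integrable_const_bound[where B = "B\<^sup>2"])
          (use power_mono[OF B abs_ge_zero, where n = 2] in auto)
    qed
    define F where "F = (LINT x|gauss. (f x)\<^sup>2)"
    have FS: "F \<le> S + 3 * (S + 1) * t"
    proof -
      have "2 * \<bar>LINT x|gauss. h x * e x\<bar> \<le> t * S + E / t"
        unfolding S_def E_def by (rule abs_integral_mult_le[OF _ _ sq ie t(1)]) simp_all
      moreover have "F = S - 2 * (LINT x|gauss. h x * e x) + E"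
      proof -
        have "integrable gauss (\<lambda>x. h x * e x)" by (rule integrable_mult_L2[OF _ _ sq ie]) simp_all
        moreover have "(f x)\<^sup>2 = (h x)\<^sup>2 - 2 * (h x * e x) + (e x)\<^sup>2" for x
          by (simp add: e_def power2_eq_square algebra_simps)
        ultimately show ?thesis
          using sq ie by (simp add: F_def S_def E_def)
      qed
      ultimately have "F \<le> S + t * S + t + t" using Et E t2 by linarith
      also have "\<dots> \<le> S + 3 * (S + 1) * t" using t S by (simp add: algebra_simps)
      finally show ?thesis .
    qed
    have ef: "(LINT x|gauss. f x)\<^sup>2 \<le> 1 * t"
    proof -
      have "(LINT x|gauss. f x) = - (LINT x|gauss. 1 * e x)"
        using integrable_mult_L2[OF _ _ one ie] integrable_mult_L2[OF _ _ one if2] h0 ih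
        by (simp add: e_def)
      moreover have "2 * \<bar>LINT x|gauss. 1 * e x\<bar> \<le> t * (LINT x|gauss. 1\<^sup>2) + E / t"
        unfolding E_def by (rule abs_integral_mult_le[OF _ _ one ie t(1)]) simp_all
      ultimately have "\<bar>LINT x|gauss. f x\<bar> \<le> t"
        using Et by (simp add: gauss.prob_space[simplified])
      then have "\<bar>LINT x|gauss. f x\<bar>\<^sup>2 \<le> t\<^sup>2" by (intro power_mono) simp_all
      then show ?thesis using t2 by simp
    qed
    have ef2: "(LINT x|gauss. (x\<^sup>2 - 1) * f x)\<^sup>2 \<le> 4 * t"
    proof -
      have i: "integrable gauss (\<lambda>x. (x\<^sup>2 - 1) * e x)" by (rule integrable_mult_L2[OF _ _ He ie]) simp_all
      have "(x\<^sup>2 - 1) * f x = x\<^sup>2 * h x - h x - (x\<^sup>2 - 1) * e x" for x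
        by (simp add: e_def algebra_simps)
      then have "(LINT x|gauss. (x\<^sup>2 - 1) * f x) = - (LINT x|gauss. (x\<^sup>2 - 1) * e x)"
        using i ih ih2 h0 h2 by simp
      moreover have "2 * \<bar>LINT x|gauss. (x\<^sup>2 - 1) * e x\<bar> \<le> t * (LINT x|gauss. (x\<^sup>2 - 1)\<^sup>2) + E / t"
        unfolding E_def by (rule abs_integral_mult_le[OF _ _ He ie t(1)]) simp_all
      ultimately have "\<bar>LINT x|gauss. (x\<^sup>2 - 1) * f x\<bar> \<le> 2 * t"
        using Et t unfolding intHe by simp
      then have "\<bar>LINT x|gauss. (x\<^sup>2 - 1) * f x\<bar>\<^sup>2 \<le> (2 * t)\<^sup>2" by (intro power_mono) simp_all
      then show ?thesis using t2 by (simp add: power_mult_distrib)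
    qed
    have m1: "(\<lambda>p. k (fst p)) \<in> borel_measurable gauss2"
      and m2: "(\<lambda>p. k (c * fst p + s * snd p)) \<in> borel_measurable gauss2"
      if "k \<in> borel_measurable borel" for k :: "real \<Rightarrow> real"
    proof -
      have "(\<lambda>p. c * fst p + s * snd p) \<in> borel_measurable gauss2"
        unfolding measurable_cong_sets[OF sets_gauss2 refl]
        by (intro borel_measurable_continuous_onI continuous_intros)
      from measurable_compose[OF this that]
      show "(\<lambda>p. k (c * fst p + s * snd p)) \<in> borel_measurable gauss2" .
      show "(\<lambda>p. k (fst p)) \<in> borel_measurable gauss2" by (rule measurable_fst_gauss2[OF that])
    qed
    have s1: "integrable gauss2 (\<lambda>p. (k (fst p))\<^sup>2)" "(LINT p|gauss2. (k (fst p))\<^sup>2) = (LINT x|gauss. (k x)\<^sup>2)"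
      "integrable gauss2 (\<lambda>p. (k (c * fst p + s * snd p))\<^sup>2)"
      "(LINT p|gauss2. (k (c * fst p + s * snd p))\<^sup>2) = (LINT x|gauss. (k x)\<^sup>2)"
      if "k \<in> borel_measurable borel" "integrable gauss (\<lambda>x. (k x)\<^sup>2)" for k :: "real \<Rightarrow> real"
    proof -
      have "(\<lambda>x. (k x)\<^sup>2) \<in> borel_measurable borel" using that(1) by simp
      note * = integral_fst_gauss2[OF this] integral_lin_gauss2[OF this cs]
      show "integrable gauss2 (\<lambda>p. (k (fst p))\<^sup>2)" "(LINT p|gauss2. (k (fst p))\<^sup>2) = (LINT x|gauss. (k x)\<^sup>2)"
        "integrable gauss2 (\<lambda>p. (k (c * fst p + s * snd p))\<^sup>2)"
        "(LINT p|gauss2. (k (c * fst p + s * snd p))\<^sup>2) = (LINT x|gauss. (k x)\<^sup>2)"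
        unfolding * by (rule that(2) refl)+
    qed
    define J where "J k l = (LINT p|gauss2. k (fst p) * l (c * fst p + s * snd p))" for k l :: "real \<Rightarrow> real"
    have Ji: "integrable gauss2 (\<lambda>p. k (fst p) * l (c * fst p + s * snd p))"
      and Jb: "2 * \<bar>J k l\<bar> \<le> r * (LINT x|gauss. (k x)\<^sup>2) + (LINT x|gauss. (l x)\<^sup>2) / r"
      if "k \<in> borel_measurable borel" "integrable gauss (\<lambda>x. (k x)\<^sup>2)"
        "l \<in> borel_measurable borel" "integrable gauss (\<lambda>x. (l x)\<^sup>2)" "0 < r" for k l r
      using integrable_mult_L2[OF m1[OF that(1)] m2[OF that(3)] s1(1)[OF that(1,2)] s1(3)[OF that(3,4)]]
        abs_integral_mult_le[OF m1[OF that(1)] m2[OF that(3)] s1(1)[OF that(1,2)] s1(3)[OF that(3,4)] that(5)]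
        s1(2)[OF that(1,2)] s1(4)[OF that(3,4)]
      by (simp_all add: J_def)
    have "h x = f x + e x" for x by (simp add: e_def)
    then have "J h h = (LINT p|gauss2. f (fst p) * f (c * fst p + s * snd p) + f (fst p) * e (c * fst p + s * snd p) +
      (e (fst p) * f (c * fst p + s * snd p) + e (fst p) * e (c * fst p + s * snd p)))"
      unfolding J_def by (simp add: algebra_simps)
    also have "\<dots> = J f f + J f e + (J e f + J e e)"
      using Ji[OF fm if2 fm if2 zero_less_one] Ji[OF fm if2 em ie zero_less_one]
        Ji[OF em ie fm if2 zero_less_one] Ji[OF em ie em ie zero_less_one]
      by (simp add: J_def)
    finally have J: "J h h = J f f + J f e + (J e f + J e e)" .
    have "J f f \<le> c ^ 4 * F + t + 2 * t"
      using cos_span_correlation_le[OF f cs] ef ef2 by (simp add: J_def F_def case_prod_unfold)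
    moreover have "2 * J f e \<le> t * F + t"
      using Jb[OF fm if2 em ie t(1)] Et by (simp add: F_def E_def)
    \<comment> \<open>The weight 1 / t is the reciprocal of the previous one because the small
      function e now comes first.\<close>
    moreover have "2 * J e f \<le> t + t * F"
      using Jb[OF em ie fm if2, of "1 / t"] Et t by (simp add: F_def E_def mult.commute)
    moreover have "J e e \<le> t"
      using Jb[OF em ie em ie zero_less_one] E t2 by (simp add: E_def)
    ultimately have "J h h \<le> c ^ 4 * F + t * F + 5 * t"
      unfolding J by linarith
    \<comment> \<open>The factor 12 is 3 + 4 + 5: replacing F by S in the main term, bounding t F
      with F \<le> 4 (S + 1), and the remaining 5 t.\<close>
    also have "\<dots> \<le> c ^ 4 * S + (S + 1) * (12 * t)"
    proof -
      have "c ^ 4 * F \<le> c ^ 4 * (S + 3 * (S + 1) * t)" using FS cs4 by (intro mult_left_mono) auto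
      also have "\<dots> = c ^ 4 * S + c ^ 4 * (3 * (S + 1) * t)" by (simp add: algebra_simps)
      also have "c ^ 4 * (3 * (S + 1) * t) \<le> 1 * (3 * (S + 1) * t)"
        using cs4 S t by (intro mult_right_mono) auto
      finally have a: "c ^ 4 * F \<le> c ^ 4 * S + 3 * (S + 1) * t" by simp
      have "3 * (S + 1) * t \<le> 3 * (S + 1)" using mult_left_le[of t "3 * (S + 1)"] S t by simp
      then have "F \<le> S + 3 * (S + 1)" using FS by linarith
      then have "t * F \<le> t * (4 * (S + 1))" using t by (intro mult_left_mono) auto
      moreover have "5 * t \<le> 5 * t * (S + 1)" using S t by (simp add: mult_le_cancel_left1)
      ultimately show ?thesis using a by (simp add: algebra_simps)
    qed
    finally show ?thesis by (simp add: J_def)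
  qed
  show ?thesis
    unfolding S_def[symmetric]
  proof (rule field_le_epsilon)
    fix d :: real assume d: "0 < d"
    define t where "t = min 1 (d / (12 * (S + 1)))"
    have "0 < t" "t \<le> 1" using d S by (auto simp: t_def)
    from key[OF this] have "(LINT p|gauss2. h (fst p) * h (c * fst p + s * snd p)) \<le> c ^ 4 * S + (S + 1) * (12 * t)" .
    moreover have "(S + 1) * (12 * t) \<le> d"
    proof -
      have "t \<le> d / (12 * (S + 1))" by (simp add: t_def)
      then show ?thesis using S by (simp add: field_simps)
    qed
    ultimately show "(LINT p|gauss2. h (fst p) * h (c * fst p + s * snd p)) \<le> c ^ 4 * S + d" by linarith
  qed
qed

section \<open>The space of collisions\<close>

definition circ :: "real measure" where
  "circ = density lborel (\<lambda>t. ennreal (indicator {-pi..pi} t / (2 * pi)))"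

lemma space_circ [simp]: "space circ = UNIV"
  and sets_circ [measurable_cong, simp]: "sets circ = sets borel"
  by (simp_all add: circ_def)

text \<open>Passing to a half-open window of length 2 \<pi>, which differs by a null set, lets
  translated windows be cut and reassembled without overlap.\<close>

lemma nn_integral_circ:
  assumes [measurable]: "f \<in> borel_measurable borel"
  shows "(\<integral>\<^sup>+t. f t \<partial>circ) = ennreal (1 / (2 * pi)) * (\<integral>\<^sup>+t. f t * indicator {-pi<..-pi+2*pi} t \<partial>lborel)"
proof -
  have "(\<integral>\<^sup>+t. f t \<partial>circ) = (\<integral>\<^sup>+t. ennreal (indicator {-pi..pi} t / (2 * pi)) * f t \<partial>lborel)"
    unfolding circ_def by (subst nn_integral_density) auto
  also have "\<dots> = (\<integral>\<^sup>+t. ennreal (1 / (2 * pi)) * (f t * indicator {-pi<..-pi+2*pi} t) \<partial>lborel)"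
  proof (rule nn_integral_cong_AE)
    show "AE t in lborel. ennreal (indicator {-pi..pi} t / (2 * pi)) * f t =
      ennreal (1 / (2 * pi)) * (f t * indicator {-pi<..-pi+2*pi} t)"
      using AE_lborel_singleton[of "- pi"]
      by eventually_elim (auto split: split_indicator)
  qed
  also have "\<dots> = ennreal (1 / (2 * pi)) * (\<integral>\<^sup>+t. f t * indicator {-pi<..-pi+2*pi} t \<partial>lborel)"
    by (rule nn_integral_cmult) simp
  finally show ?thesis .
qed

interpretation circ: prob_space circ
proof
  have "emeasure circ (space circ) = (\<integral>\<^sup>+t. 1 \<partial>circ)" by simp
  also have "\<dots> = ennreal (1 / (2 * pi)) * ennreal (2 * pi)"
    by (subst nn_integral_circ) simp_all
  also have "\<dots> = 1" by (subst ennreal_mult[symmetric]) simp_all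
  finally show "emeasure circ (space circ) = 1" .
qed

text \<open>The piece of the translated window that sticks out on the right is moved back by one
  period and fills the gap on the left.\<close>

lemma nn_integral_period_shift:
  fixes f :: "real \<Rightarrow> ennreal"
  assumes [measurable]: "f \<in> borel_measurable borel" and per: "\<And>x. f (x + 2 * pi) = f x"
    and a: "0 \<le> a" "a \<le> 2 * pi"
  shows "(\<integral>\<^sup>+t. f t * indicator {b+a<..b+a+2*pi} t \<partial>lborel) = (\<integral>\<^sup>+t. f t * indicator {b<..b+2*pi} t \<partial>lborel)"
proof -
  have "(\<integral>\<^sup>+t. f t * indicator {b+a<..b+a+2*pi} t \<partial>lborel) =
    (\<integral>\<^sup>+t. f t * indicator {b+a<..b+2*pi} t + f t * indicator {b+2*pi<..b+a+2*pi} t \<partial>lborel)"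
    using a by (intro nn_integral_cong) (auto split: split_indicator)
  also have "\<dots> = (\<integral>\<^sup>+t. f t * indicator {b+a<..b+2*pi} t \<partial>lborel) + (\<integral>\<^sup>+t. f t * indicator {b+2*pi<..b+a+2*pi} t \<partial>lborel)"
    by (rule nn_integral_add) simp_all
  also have "(\<integral>\<^sup>+t. f t * indicator {b+2*pi<..b+a+2*pi} t \<partial>lborel) = (\<integral>\<^sup>+t. f (2 * pi + 1 * t) * indicator {b+2*pi<..b+a+2*pi} (2 * pi + 1 * t) \<partial>lborel)"
    by (subst nn_integral_real_affine[where c = 1 and t = "2 * pi"]) simp_all
  also have "\<dots> = (\<integral>\<^sup>+t. f t * indicator {b<..b+a} t \<partial>lborel)"
    using per by (intro nn_integral_cong) (auto simp: add.commute split: split_indicator)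
  also have "(\<integral>\<^sup>+t. f t * indicator {b+a<..b+2*pi} t \<partial>lborel) + \<dots> = (\<integral>\<^sup>+t. f t * indicator {b+a<..b+2*pi} t + f t * indicator {b<..b+a} t \<partial>lborel)"
    by (rule nn_integral_add[symmetric]) simp_all
  also have "\<dots> = (\<integral>\<^sup>+t. f t * indicator {b<..b+2*pi} t \<partial>lborel)"
    using a by (intro nn_integral_cong) (auto split: split_indicator)
  finally show ?thesis .
qed

lemma nn_integral_circ_shift:
  fixes f :: "real \<Rightarrow> ennreal"
  assumes f[measurable]: "f \<in> borel_measurable borel" and per: "\<And>x. f (x + 2 * pi) = f x"
    and a: "\<bar>a\<bar> \<le> 2 * pi"
  shows "(\<integral>\<^sup>+t. f (t + a) \<partial>circ) = (\<integral>\<^sup>+t. f t \<partial>circ)"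
proof -
  have "(\<integral>\<^sup>+t. f (t + a) * indicator {-pi<..-pi+2*pi} t \<partial>lborel) =
    (\<integral>\<^sup>+t. f t * indicator {-pi+a<..-pi+a+2*pi} t \<partial>lborel)"
    by (subst nn_integral_real_affine[where c = 1 and t = a and f = "\<lambda>t. f t * indicator {-pi+a<..-pi+a+2*pi} t"])
      (auto simp: add.commute intro!: nn_integral_cong split: split_indicator)
  also have "\<dots> = (\<integral>\<^sup>+t. f t * indicator {-pi<..-pi+2*pi} t \<partial>lborel)"
  proof (cases "0 \<le> a")
    case True
    then show ?thesis using a by (intro nn_integral_period_shift[OF f per]) auto
  next
    case False
    \<comment> \<open>For negative a the roles are exchanged: the translated window, moved right by
      -a, becomes the original one.\<close>
    then show ?thesis using a nn_integral_period_shift[OF f per, of "- a" "- pi + a"] by simp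
  qed
  finally show ?thesis by (simp add: nn_integral_circ)
qed

lemma integral_circ_shift:
  fixes f :: "real \<Rightarrow> real"
  assumes f[measurable]: "f \<in> borel_measurable borel" and per: "\<And>x. f (x + 2 * pi) = f x"
    and a: "\<bar>a\<bar> \<le> 2 * pi" and i: "integrable circ f"
  shows "integrable circ (\<lambda>t. f (t + a))" and "(LINT t|circ. f (t + a)) = (LINT t|circ. f t)"
proof -
  show i': "integrable circ (\<lambda>t. f (t + a))"
    using i nn_integral_circ_shift[of "\<lambda>t. ennreal (norm (f t))" a] per a
    unfolding integrable_iff_bounded by simp
  show "(LINT t|circ. f (t + a)) = (LINT t|circ. f t)"
    unfolding real_lebesgue_integral_def[OF i] real_lebesgue_integral_def[OF i']
    using nn_integral_circ_shift[of "\<lambda>t. ennreal (f t)" a] nn_integral_circ_shift[of "\<lambda>t. ennreal (- f t)" a] per a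
    by simp
qed

lemma nn_integral_circ_uminus:
  fixes f :: "real \<Rightarrow> ennreal"
  assumes [measurable]: "f \<in> borel_measurable borel"
  shows "(\<integral>\<^sup>+t. f (- t) \<partial>circ) = (\<integral>\<^sup>+t. f t \<partial>circ)"
proof -
  have "(\<integral>\<^sup>+t. f t \<partial>circ) = (\<integral>\<^sup>+t. ennreal (indicator {-pi..pi} t / (2 * pi)) * f t \<partial>lborel)"
    unfolding circ_def by (subst nn_integral_density) auto
  also have "\<dots> = (\<integral>\<^sup>+t. ennreal (indicator {-pi..pi} (0 + (-1) * t) / (2 * pi)) * f (0 + (-1) * t) \<partial>lborel)"
    by (subst nn_integral_real_affine[where c = "-1" and t = 0]) simp_all
  also have "\<dots> = (\<integral>\<^sup>+t. ennreal (indicator {-pi..pi} t / (2 * pi)) * f (- t) \<partial>lborel)"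
    by (intro nn_integral_cong) (auto split: split_indicator)
  also have "\<dots> = (\<integral>\<^sup>+t. f (- t) \<partial>circ)"
    unfolding circ_def by (subst nn_integral_density) auto
  finally show ?thesis by simp
qed

section \<open>The Gaussian pair with an independent angle\<close>

interpretation kac: pair_prob_space gauss2 circ
  by unfold_locales

abbreviation kac_space :: "((real \<times> real) \<times> real) measure" where
  "kac_space \<equiv> gauss2 \<Otimes>\<^sub>M circ"

lemma sets_kac_space: "sets kac_space = sets borel"
proof -
  have "sets kac_space = sets (borel \<Otimes>\<^sub>M borel)"
    by (intro sets_pair_measure_cong sets_gauss2 sets_circ)
  then show ?thesis unfolding borel_prod .
qed

lemma borel_measurable_kac_space: "borel_measurable kac_space = borel_measurable borel"
  by (rule measurable_cong_sets[OF sets_kac_space refl])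

lemma nn_integral_gauss2_swap:
  fixes f :: "real \<times> real \<Rightarrow> ennreal"
  assumes "f \<in> borel_measurable borel"
  shows "(\<integral>\<^sup>+p. f (snd p, fst p) \<partial>gauss2) = (\<integral>\<^sup>+p. f p \<partial>gauss2)"
proof -
  have [measurable]: "f \<in> borel_measurable gauss2"
    unfolding measurable_cong_sets[OF sets_gauss2 refl] by (rule assms)
  have "(\<integral>\<^sup>+p. f p \<partial>gauss2) = (\<integral>\<^sup>+p. f p \<partial>distr gauss2 gauss2 (\<lambda>(x, y). (y, x)))"
    using gauss2.distr_pair_swap by simp
  also have "\<dots> = (\<integral>\<^sup>+p. f (snd p, fst p) \<partial>gauss2)"
    by (subst nn_integral_distr) (simp_all add: case_prod_unfold)
  finally show ?thesis by simp
qed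

text \<open>Both symmetries of the collision, the exchange of the particles and its reversal, act on the
  angle by \<open>\<theta> \<mapsto> - \<theta>\<close>.\<close>

lemma distr_skew_kac_space:
  fixes T :: "real \<Rightarrow> real \<times> real \<Rightarrow> real \<times> real"
  assumes T: "(\<lambda>q. T (snd q) (fst q)) \<in> borel_measurable borel"
    and pres: "\<And>t f. f \<in> borel_measurable borel \<Longrightarrow> (\<integral>\<^sup>+p. f (T t p) \<partial>gauss2) = (\<integral>\<^sup>+p. f p \<partial>gauss2)"
  shows "distr kac_space kac_space (\<lambda>q. (T (snd q) (fst q), - snd q)) = kac_space" (is "distr _ _ ?T = _")
proof (rule measure_eqI)
  have Tb: "?T \<in> borel_measurable borel"
    using T by (intro borel_measurable_Pair) (auto intro!: borel_measurable_continuous_onI continuous_intros)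
  then have m: "?T \<in> measurable kac_space kac_space"
    unfolding measurable_cong_sets[OF sets_kac_space sets_kac_space] .
  fix A assume "A \<in> sets (distr kac_space kac_space ?T)"
  then have AK: "A \<in> sets kac_space" by simp
  then have A: "A \<in> sets borel" unfolding sets_kac_space .
  define f :: "(real \<times> real) \<times> real \<Rightarrow> ennreal" where "f = indicator A"
  have fb: "f \<in> borel_measurable borel" using A by (simp add: f_def)
  have fK: "f \<in> borel_measurable kac_space" using fb unfolding borel_measurable_kac_space .
  have sec: "(\<lambda>p. f (p, t)) \<in> borel_measurable borel" for t
    by (rule measurable_compose[OF _ fb]) (auto intro!: borel_measurable_continuous_onI continuous_intros)
  have in1: "(\<lambda>t. \<integral>\<^sup>+p. f (p, t) \<partial>gauss2) \<in> borel_measurable borel"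
  proof -
    have "(\<lambda>(t, p). f (p, t)) \<in> borel_measurable (borel \<Otimes>\<^sub>M gauss2)"
      unfolding measurable_cong_sets[OF sets_pair_measure_cong[OF refl sets_gauss2] refl] borel_prod
      unfolding case_prod_unfold
      by (rule measurable_compose[OF _ fb]) (intro borel_measurable_continuous_onI continuous_intros)
    then show ?thesis by (rule gauss2.P.borel_measurable_nn_integral)
  qed
  have fT: "(\<lambda>q. f (?T q)) \<in> borel_measurable kac_space"
    by (rule measurable_compose[OF m fK])
  have "emeasure (distr kac_space kac_space ?T) A = (\<integral>\<^sup>+q. f q \<partial>distr kac_space kac_space ?T)"
    unfolding f_def using AK by (intro nn_integral_indicator[symmetric]) simp
  also have "\<dots> = (\<integral>\<^sup>+q. f (?T q) \<partial>kac_space)"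
    by (rule nn_integral_distr[OF m]) (simp add: fK)
  also have "\<dots> = (\<integral>\<^sup>+t. \<integral>\<^sup>+p. f (T t p, - t) \<partial>gauss2 \<partial>circ)"
    using kac.nn_integral_snd[OF fT] by simp
  also have "\<dots> = (\<integral>\<^sup>+t. \<integral>\<^sup>+p. f (p, - t) \<partial>gauss2 \<partial>circ)"
    by (intro nn_integral_cong pres[OF sec])
  also have "\<dots> = (\<integral>\<^sup>+t. \<integral>\<^sup>+p. f (p, t) \<partial>gauss2 \<partial>circ)"
    by (rule nn_integral_circ_uminus[OF in1])
  also have "\<dots> = (\<integral>\<^sup>+q. f q \<partial>kac_space)"
    using kac.nn_integral_snd[OF fK] by simp
  also have "\<dots> = emeasure kac_space A"
    unfolding f_def using AK by (rule nn_integral_indicator)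
  finally show "emeasure (distr kac_space kac_space ?T) A = emeasure kac_space A" .
qed simp

text \<open>Rotations act on the velocity pair at a fixed angle, which calls for the grouping ((v,
  w), \<theta>), whereas the form is integrated over (v, (w, \<theta>)). This regrouping connects
  the two.\<close>

lemma kac_space_assoc:
  "distr kac_space (gauss \<Otimes>\<^sub>M (gauss \<Otimes>\<^sub>M circ)) (\<lambda>q. (fst (fst q), snd (fst q), snd q)) =
    gauss \<Otimes>\<^sub>M (gauss \<Otimes>\<^sub>M circ)" (is "distr _ ?M ?T = _")
proof (rule measure_eqI)
  interpret wc: pair_prob_space gauss circ ..
  have m: "?T \<in> measurable kac_space ?M" by measurable
  fix A assume "A \<in> sets (distr kac_space ?M ?T)"
  then have A: "A \<in> sets ?M" by simp
  define f :: "real \<times> real \<times> real \<Rightarrow> ennreal" where "f = indicator A"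
  have f[measurable]: "f \<in> borel_measurable ?M" using A by (simp add: f_def)
  have fT: "(\<lambda>q. f (?T q)) \<in> borel_measurable kac_space" by (rule measurable_compose[OF m f])
  have fT2: "(\<lambda>p. \<integral>\<^sup>+t. f (fst p, snd p, t) \<partial>circ) \<in> borel_measurable gauss2"
    using circ.borel_measurable_nn_integral_fst[OF fT] by simp
  have "emeasure (distr kac_space ?M ?T) A = (\<integral>\<^sup>+q. f q \<partial>distr kac_space ?M ?T)"
    unfolding f_def using A by (intro nn_integral_indicator[symmetric]) simp
  also have "\<dots> = (\<integral>\<^sup>+q. f (?T q) \<partial>kac_space)" by (rule nn_integral_distr[OF m]) (simp add: f)
  also have "\<dots> = (\<integral>\<^sup>+p. \<integral>\<^sup>+t. f (fst p, snd p, t) \<partial>circ \<partial>gauss2)"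
    using circ.nn_integral_fst[OF fT] by simp
  also have "\<dots> = (\<integral>\<^sup>+v. \<integral>\<^sup>+w. \<integral>\<^sup>+t. f (v, w, t) \<partial>circ \<partial>gauss \<partial>gauss)"
    using gauss.nn_integral_fst[OF fT2] by simp
  also have "\<dots> = (\<integral>\<^sup>+v. \<integral>\<^sup>+p. f (v, p) \<partial>(gauss \<Otimes>\<^sub>M circ) \<partial>gauss)"
  proof (rule nn_integral_cong)
    fix v :: real
    have "(\<lambda>p. f (v, p)) \<in> borel_measurable (gauss \<Otimes>\<^sub>M circ)"
      by (rule measurable_compose[OF _ f]) simp
    from circ.nn_integral_fst[OF this]
    show "(\<integral>\<^sup>+w. \<integral>\<^sup>+t. f (v, w, t) \<partial>circ \<partial>gauss) = (\<integral>\<^sup>+p. f (v, p) \<partial>(gauss \<Otimes>\<^sub>M circ))" .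
  qed
  also have "\<dots> = (\<integral>\<^sup>+q. f q \<partial>?M)" by (rule wc.P.nn_integral_fst[OF f])
  also have "\<dots> = emeasure ?M A" unfolding f_def using A by (rule nn_integral_indicator)
  finally show "emeasure (distr kac_space ?M ?T) A = emeasure ?M A" .
qed simp

lemma kac_space_density:
  "gauss \<Otimes>\<^sub>M (gauss \<Otimes>\<^sub>M circ) =
    density lborel (\<lambda>(v, w, t). ennreal (Maxw v * Maxw w * indicator {-pi..pi} t / (2 * pi)))"
proof -
  interpret wc: pair_prob_space gauss circ ..
  have wc: "gauss \<Otimes>\<^sub>M circ = density (lborel \<Otimes>\<^sub>M lborel) (\<lambda>(w, t). ennreal (Maxw w) * ennreal (indicator {-pi..pi} t / (2 * pi)))"
    unfolding gauss_def circ_def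
    by (intro pair_measure_density lborel.sigma_finite_measure_axioms)
      (simp_all add: circ.sigma_finite_measure_axioms[unfolded circ_def])
  have "gauss \<Otimes>\<^sub>M (gauss \<Otimes>\<^sub>M circ) = density (lborel \<Otimes>\<^sub>M (lborel \<Otimes>\<^sub>M lborel))
    (\<lambda>(v, p). ennreal (Maxw v) * (case p of (w, t) \<Rightarrow> ennreal (Maxw w) * ennreal (indicator {-pi..pi} t / (2 * pi))))"
    unfolding wc unfolding gauss_def
    by (intro pair_measure_density lborel_pair.sigma_finite_measure_axioms)
      (use wc.sigma_finite_measure_axioms[unfolded wc] in \<open>simp_all\<close>)
  also have "(\<lambda>(v, p). ennreal (Maxw v) * (case p of (w, t) \<Rightarrow> ennreal (Maxw w) * ennreal (indicator {-pi..pi} t / (2 * pi)))) =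
    (\<lambda>(v, w, t). ennreal (Maxw v * Maxw w * indicator {-pi..pi} t / (2 * pi)))"
    by (auto simp: fun_eq_iff ennreal_mult[symmetric] mult.assoc)
  finally show ?thesis by (simp add: lborel_prod)
qed

section \<open>The quadratic form as an expectation\<close>

definition pair_sum :: "(real \<Rightarrow> real) \<Rightarrow> real \<times> real \<Rightarrow> real" where
  "pair_sum h p = h (fst p) + h (snd p)"

definition collide :: "(real \<times> real) \<times> real \<Rightarrow> real \<times> real" where
  "collide q = rot (cos (snd q)) (sin (snd q)) (fst q)"

lemma collide_measurable [measurable]: "collide \<in> borel_measurable borel"
  unfolding collide_def rot_def by (intro borel_measurable_continuous_onI continuous_intros)

lemma pair_sum_measurable:
  assumes "h \<in> borel_measurable borel"
  shows "pair_sum h \<in> borel_measurable borel"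
  unfolding pair_sum_def
  by (intro borel_measurable_add measurable_compose[OF _ assms] borel_measurable_continuous_onI continuous_intros)

lemma kac_integrand_eq:
  "kac_integrand \<gamma> h v w t =
    ((v\<^sup>2 + w\<^sup>2) powr \<gamma> * h v * (pair_sum h (collide ((v, w), t)) - pair_sum h (v, w))) * (Maxw v * Maxw w)"
  by (simp add: kac_integrand_def post_v_def post_w_def pair_sum_def collide_def rot_def power2_eq_square algebra_simps)

text \<open>The normalization of the angle by 2 \<pi> against the prefactor 1 / \<pi> of the form
  leaves the factor 2.\<close>

lemma kac_form_kac_space:
  fixes h :: "real \<Rightarrow> real" and \<gamma> :: real
  assumes h: "h \<in> borel_measurable borel"
  defines "a \<equiv> \<lambda>q. ((fst (fst q))\<^sup>2 + (snd (fst q))\<^sup>2) powr \<gamma> * h (fst (fst q)) * (pair_sum h (collide q) - pair_sum h (fst q))"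
  shows "kac_form_converges \<gamma> h \<longleftrightarrow> integrable kac_space a"
    and "kac_form \<gamma> h = 2 * (LINT q|kac_space. a q)"
proof -
  have am: "a \<in> borel_measurable borel"
    unfolding a_def
    by (intro borel_measurable_times borel_measurable_diff powr_real_measurable borel_measurable_const
        measurable_compose[OF collide_measurable pair_sum_measurable[OF h]]
        measurable_compose[OF _ pair_sum_measurable[OF h]] measurable_compose[OF _ h])
      (intro borel_measurable_continuous_onI continuous_intros)+
  let ?M = "gauss \<Otimes>\<^sub>M (gauss \<Otimes>\<^sub>M circ)"
  define g where "g z = a ((fst z, fst (snd z)), snd (snd z))" for z :: "real \<times> real \<times> real"
  define D where "D z = (case z of (v, w, t) \<Rightarrow> Maxw v * Maxw w * indicator {-pi..pi} t / (2 * pi))" for z :: "real \<times> real \<times> real"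
  have gm: "g \<in> borel_measurable borel"
    unfolding g_def
    by (rule measurable_compose[OF _ am]) (intro borel_measurable_continuous_onI continuous_intros)
  have [measurable]: "g \<in> borel_measurable lborel" using gm by simp
  have Dm[measurable]: "D \<in> borel_measurable lborel"
    unfolding D_def by (simp add: lborel_prod[symmetric])
  have gM: "g \<in> borel_measurable ?M"
    using gm unfolding kac_space_density by simp
  have M: "?M = density lborel (\<lambda>z. ennreal (D z))"
    unfolding kac_space_density D_def by (simp add: case_prod_unfold)
  have D0: "AE z in lborel. 0 \<le> D z"
    by (auto simp: D_def split: split_indicator)
  have m: "(\<lambda>q. (fst (fst q), snd (fst q), snd q)) \<in> measurable kac_space ?M" by measurable
  have eq: "indicator kac_dom z *\<^sub>R (case z of (v, w, t) \<Rightarrow> kac_integrand \<gamma> h v w t) = (2 * pi) * (D z *\<^sub>R g z)" for z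
    by (cases z) (auto simp: kac_dom_def D_def g_def a_def kac_integrand_eq split: split_indicator)
  have "integrable kac_space a \<longleftrightarrow> integrable ?M g"
    using integrable_distr_eq[OF m gM] unfolding kac_space_assoc by (simp add: g_def)
  also have "\<dots> \<longleftrightarrow> integrable lborel (\<lambda>z. D z *\<^sub>R g z)"
    unfolding M by (rule integrable_density[OF _ Dm D0]) simp
  also have "\<dots> \<longleftrightarrow> kac_form_converges \<gamma> h"
    unfolding kac_form_converges_def set_integrable_def eq by (subst integrable_mult_left_iff) simp
  finally show "kac_form_converges \<gamma> h \<longleftrightarrow> integrable kac_space a" by simp
  have "(LINT q|kac_space. a q) = (LINT z|?M. g z)"
    using integral_distr[OF m gM] unfolding kac_space_assoc by (simp add: g_def[abs_def])
  also have "\<dots> = (LINT z|lborel. D z *\<^sub>R g z)"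
    unfolding M by (rule integral_density[OF _ Dm D0]) simp
  finally show "kac_form \<gamma> h = 2 * (LINT q|kac_space. a q)"
    unfolding kac_form_def set_lebesgue_integral_def eq by simp
qed

section \<open>Reversal and exchange in a collision\<close>

lemma
  fixes T :: "real \<Rightarrow> real \<times> real \<Rightarrow> real \<times> real" and f :: "(real \<times> real) \<times> real \<Rightarrow> real"
  assumes T: "(\<lambda>q. T (snd q) (fst q)) \<in> borel_measurable borel"
    and pres: "\<And>t f. f \<in> borel_measurable borel \<Longrightarrow> (\<integral>\<^sup>+p. f (T t p) \<partial>gauss2) = (\<integral>\<^sup>+p. f p \<partial>gauss2)"
    and f: "f \<in> borel_measurable borel"
  shows integrable_skew_kac_space: "integrable kac_space (\<lambda>q. f (T (snd q) (fst q), - snd q)) \<longleftrightarrow> integrable kac_space f"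
    and integral_skew_kac_space: "(LINT q|kac_space. f (T (snd q) (fst q), - snd q)) = (LINT q|kac_space. f q)"
proof -
  have "(\<lambda>q. (T (snd q) (fst q), - snd q)) \<in> borel_measurable borel"
    using T by (intro borel_measurable_Pair) (auto intro!: borel_measurable_continuous_onI continuous_intros)
  then have m: "(\<lambda>q. (T (snd q) (fst q), - snd q)) \<in> measurable kac_space kac_space"
    unfolding measurable_cong_sets[OF sets_kac_space sets_kac_space] .
  have fK: "f \<in> borel_measurable kac_space" unfolding borel_measurable_kac_space by (rule f)
  have d: "distr kac_space kac_space (\<lambda>q. (T (snd q) (fst q), - snd q)) = kac_space"
    by (rule distr_skew_kac_space[OF T]) (rule pres)
  show "integrable kac_space (\<lambda>q. f (T (snd q) (fst q), - snd q)) \<longleftrightarrow> integrable kac_space f"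
    using integrable_distr_eq[OF m fK] unfolding d by simp
  show "(LINT q|kac_space. f (T (snd q) (fst q), - snd q)) = (LINT q|kac_space. f q)"
    using integral_distr[OF m fK] unfolding d by simp
qed

text \<open>At each fixed angle the velocities undergo a rotation, which preserves the Gaussian
  pair. Since the angle changes sign, a second application restores the original collision, so
  incoming and outgoing pairs trade places.\<close>

lemma
  fixes f :: "(real \<times> real) \<times> real \<Rightarrow> real"
  assumes f: "f \<in> borel_measurable borel"
  shows integrable_reverse: "integrable kac_space (\<lambda>q. f (collide q, - snd q)) \<longleftrightarrow> integrable kac_space f"
    and integral_reverse: "(LINT q|kac_space. f (collide q, - snd q)) = (LINT q|kac_space. f q)"
proof -
  have T: "(\<lambda>q. rot (cos (snd q)) (sin (snd q)) (fst q)) \<in> borel_measurable borel"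
    using collide_measurable by (simp add: collide_def[abs_def])
  have P: "(\<integral>\<^sup>+p. g (rot (cos t) (sin t) p) \<partial>gauss2) = (\<integral>\<^sup>+p. g p \<partial>gauss2)"
    if "g \<in> borel_measurable borel" for t and g :: "real \<times> real \<Rightarrow> ennreal"
    by (rule nn_integral_rot_gauss2[OF that]) simp
  show "integrable kac_space (\<lambda>q. f (collide q, - snd q)) \<longleftrightarrow> integrable kac_space f"
    "(LINT q|kac_space. f (collide q, - snd q)) = (LINT q|kac_space. f q)"
    unfolding collide_def
    by (rule integrable_skew_kac_space[OF T _ f] integral_skew_kac_space[OF T _ f], erule P)+
qed

text \<open>Swapping the incoming velocities and reversing the angle swaps the outgoing velocities
  too; a sum over both particles does not notice.\<close>

lemma
  fixes f :: "(real \<times> real) \<times> real \<Rightarrow> real"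
  assumes f: "f \<in> borel_measurable borel"
  shows integrable_exchange:
      "integrable kac_space (\<lambda>q. f ((snd (fst q), fst (fst q)), - snd q)) \<longleftrightarrow> integrable kac_space f"
    and integral_exchange:
      "(LINT q|kac_space. f ((snd (fst q), fst (fst q)), - snd q)) = (LINT q|kac_space. f q)"
proof -
  have T: "(\<lambda>q::(real \<times> real) \<times> real. (snd (fst q), fst (fst q))) \<in> borel_measurable borel"
    by (intro borel_measurable_continuous_onI continuous_intros)
  show "integrable kac_space (\<lambda>q. f ((snd (fst q), fst (fst q)), - snd q)) \<longleftrightarrow> integrable kac_space f"
    by (rule integrable_skew_kac_space[OF T _ f]) (rule nn_integral_gauss2_swap)
  show "(LINT q|kac_space. f ((snd (fst q), fst (fst q)), - snd q)) = (LINT q|kac_space. f q)"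
    by (rule integral_skew_kac_space[OF T _ f]) (rule nn_integral_gauss2_swap)
qed

lemma rot_rot: "rot (cos a) (sin a) (rot (cos b) (sin b) p) = rot (cos (a + b)) (sin (a + b)) p"
  by (simp add: rot_def cos_add sin_add algebra_simps)

lemma collide_reverse: "collide (collide q, - snd q) = fst q"
  using rot_rot[of "- snd q" "snd q" "fst q"] by (simp add: collide_def rot_def)

lemma pair_sum_exchange: "pair_sum h (snd p, fst p) = pair_sum h p"
  by (simp add: pair_sum_def)

lemma pair_sum_collide_exchange:
  "pair_sum h (collide ((snd (fst q), fst (fst q)), - snd q)) = pair_sum h (collide q)"
  by (simp add: pair_sum_def collide_def rot_def algebra_simps)

text \<open>The separate terms of the form need not be integrable, so that it has to be symmetrized as a whole.\<close>

lemma kac_space_symmetrization: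
  fixes h :: "real \<Rightarrow> real" and w :: "real \<times> real \<Rightarrow> real"
  assumes h: "h \<in> borel_measurable borel" and w: "w \<in> borel_measurable borel"
    and w_rot: "\<And>c s p. c\<^sup>2 + s\<^sup>2 = 1 \<Longrightarrow> w (rot c s p) = w p"
    and w_swap: "\<And>p. w (snd p, fst p) = w p"
  defines "a \<equiv> \<lambda>q. w (fst q) * h (fst (fst q)) * (pair_sum h (collide q) - pair_sum h (fst q))"
  assumes a: "integrable kac_space a"
  shows "integrable kac_space (\<lambda>q. w (fst q) * (pair_sum h (collide q) - pair_sum h (fst q))\<^sup>2)"
    and "(LINT q|kac_space. w (fst q) * (pair_sum h (collide q) - pair_sum h (fst q))\<^sup>2) = - 4 * (LINT q|kac_space. a q)"
proof -
  have fstm: "(fst :: (real \<times> real) \<times> real \<Rightarrow> _) \<in> borel_measurable borel"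
    "(\<lambda>q::(real \<times> real) \<times> real. fst (fst q)) \<in> borel_measurable borel"
    by (intro borel_measurable_continuous_onI continuous_intros)+
  have am: "a \<in> borel_measurable borel"
    unfolding a_def
    by (intro borel_measurable_times borel_measurable_diff
        measurable_compose[OF collide_measurable pair_sum_measurable[OF h]]
        measurable_compose[OF fstm(1) pair_sum_measurable[OF h]]
        measurable_compose[OF fstm(2) h] measurable_compose[OF fstm(1) w])
  define b where "b q = w (fst q) * pair_sum h (fst q) * (pair_sum h (collide q) - pair_sum h (fst q))" for q
  have bm: "b \<in> borel_measurable borel"
    unfolding b_def
    by (intro borel_measurable_times borel_measurable_diff
        measurable_compose[OF collide_measurable pair_sum_measurable[OF h]]
        measurable_compose[OF fstm(1) pair_sum_measurable[OF h]] measurable_compose[OF fstm(1) w])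
  \<comment> \<open>Adding the exchanged copy turns the factor h(v) into the full pair sum.\<close>
  have b: "b q = a q + a ((snd (fst q), fst (fst q)), - snd q)" for q
    by (simp add: b_def a_def pair_sum_exchange pair_sum_collide_exchange w_swap)
      (simp add: pair_sum_def algebra_simps)
  have bi: "integrable kac_space b" and bI: "(LINT q|kac_space. b q) = 2 * (LINT q|kac_space. a q)"
    unfolding b using a integrable_exchange[OF am] integral_exchange[OF am] by simp_all
  have wc: "w (collide q) = w (fst q)" for q
    unfolding collide_def by (rule w_rot) simp
  \<comment> \<open>Reversal interchanges the pair sums before and after the collision, so adding
    the reversed copy completes the square. The two symmetrizations contribute a factor 2 each, and
    the sign is negative.\<close>
  have d: "w (fst q) * (pair_sum h (collide q) - pair_sum h (fst q))\<^sup>2 = - (b q + b (collide q, - snd q))" for q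
    unfolding b_def collide_reverse fst_conv wc by (simp add: power2_eq_square algebra_simps)
  show "integrable kac_space (\<lambda>q. w (fst q) * (pair_sum h (collide q) - pair_sum h (fst q))\<^sup>2)"
    "(LINT q|kac_space. w (fst q) * (pair_sum h (collide q) - pair_sum h (fst q))\<^sup>2) = - 4 * (LINT q|kac_space. a q)"
    unfolding d using bi bI integrable_reverse[OF bm] integral_reverse[OF bm] by simp_all
qed

lemma fst_kac_measurable:
  assumes "f \<in> borel_measurable borel"
  shows "(\<lambda>q::(real \<times> real) \<times> real. f (fst q)) \<in> borel_measurable borel"
  by (rule measurable_compose[OF _ assms]) (intro borel_measurable_continuous_onI continuous_intros)

lemma
  fixes k :: "real \<times> real \<Rightarrow> real"
  assumes k: "k \<in> borel_measurable borel"
  shows integrable_fst_kac: "integrable kac_space (\<lambda>q. k (fst q)) \<longleftrightarrow> integrable gauss2 k"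
    and integral_fst_kac: "(LINT q|kac_space. k (fst q)) = (LINT p|gauss2. k p)"
proof -
  have kG: "k \<in> borel_measurable gauss2" using k unfolding measurable_cong_sets[OF sets_gauss2 refl] .
  have d: "distr kac_space gauss2 fst = gauss2" by (rule circ.distr_pair_fst)
  show "integrable kac_space (\<lambda>q. k (fst q)) \<longleftrightarrow> integrable gauss2 k"
    using integrable_distr_eq[OF measurable_fst[of gauss2 circ] kG] unfolding d by simp
  show "(LINT q|kac_space. k (fst q)) = (LINT p|gauss2. k p)"
    using integral_distr[OF measurable_fst[of gauss2 circ] kG] unfolding d by simp
qed

text \<open>By reversal the outgoing pair has the same law as the incoming one.\<close>

lemma
  fixes k :: "real \<times> real \<Rightarrow> real"
  assumes k: "k \<in> borel_measurable borel"
  shows integrable_collide: "integrable kac_space (\<lambda>q. k (collide q)) \<longleftrightarrow> integrable gauss2 k"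
    and integral_collide: "(LINT q|kac_space. k (collide q)) = (LINT p|gauss2. k p)"
  using integrable_reverse[OF fst_kac_measurable[OF k]] integral_reverse[OF fst_kac_measurable[OF k]]
    integrable_fst_kac[OF k] integral_fst_kac[OF k] by simp_all

section \<open>The dissipation\<close>

definition rotation_correlation :: "(real \<times> real \<Rightarrow> real) \<Rightarrow> (real \<times> real \<Rightarrow> real) \<Rightarrow> real \<Rightarrow> real" where
  "rotation_correlation w H t = (LINT p|gauss2. w p * (H p * H (rot (cos t) (sin t) p)))"

lemma rotation_correlation_periodic:
  "rotation_correlation w H (t + 2 * pi) = rotation_correlation w H t"
  by (simp add: rotation_correlation_def)

context
  fixes w H :: "real \<times> real \<Rightarrow> real"
  assumes w: "w \<in> borel_measurable borel" and H: "H \<in> borel_measurable borel"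
    and w01: "\<And>p. 0 \<le> w p" "\<And>p. w p \<le> 1"
    and w_rot: "\<And>c s p. c\<^sup>2 + s\<^sup>2 = 1 \<Longrightarrow> w (rot c s p) = w p"
    and sq: "integrable gauss2 (\<lambda>p. (H p)\<^sup>2)"
begin

lemma weighted_product_le: "\<bar>w p * (x * y)\<bar> \<le> (x\<^sup>2 + y\<^sup>2) / 2"
proof -
  have "\<bar>w p * (x * y)\<bar> \<le> \<bar>x\<bar> * \<bar>y\<bar>"
    using w01[of p] by (simp add: abs_mult mult_left_le_one_le)
  also have "\<dots> \<le> (x\<^sup>2 + y\<^sup>2) / 2"
    using sum_squares_bound[of "\<bar>x\<bar>" "\<bar>y\<bar>"] by simp
  finally show ?thesis .
qed

lemma H2_measurable: "(\<lambda>p. (H p)\<^sup>2) \<in> borel_measurable borel"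
  using H by simp

lemma integrable_correlation: "integrable kac_space (\<lambda>q. w (fst q) * (H (fst q) * H (collide q)))"
proof (rule Bochner_Integration.integrable_bound)
  show "integrable kac_space (\<lambda>q. ((H (fst q))\<^sup>2 + (H (collide q))\<^sup>2) / 2)"
    using integrable_fst_kac[OF H2_measurable] integrable_collide[OF H2_measurable] sq by simp
  show "(\<lambda>q. w (fst q) * (H (fst q) * H (collide q))) \<in> borel_measurable kac_space"
    unfolding borel_measurable_kac_space
    by (intro borel_measurable_times fst_kac_measurable w H measurable_compose[OF collide_measurable H])
  show "AE q in kac_space. norm (w (fst q) * (H (fst q) * H (collide q))) \<le> norm (((H (fst q))\<^sup>2 + (H (collide q))\<^sup>2) / 2)"
    by (rule AE_I2) (use weighted_product_le in simp)
qed

lemma integral_correlation: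
  "(LINT q|kac_space. w (fst q) * (H (fst q) * H (collide q))) = (LINT t|circ. rotation_correlation w H t)"
  "integrable circ (rotation_correlation w H)"
proof -
  have i: "integrable kac_space (case_prod (\<lambda>p t. w p * (H p * H (collide (p, t)))))"
    using integrable_correlation by (simp add: case_prod_unfold)
  from kac.integral_snd[OF i] kac.integrable_snd[OF i]
  show "(LINT q|kac_space. w (fst q) * (H (fst q) * H (collide q))) = (LINT t|circ. rotation_correlation w H t)"
    "integrable circ (rotation_correlation w H)"
    by (simp_all add: rotation_correlation_def[abs_def] collide_def case_prod_unfold)
qed

lemma rot_measurable': "(\<lambda>p. H (rot c s p)) \<in> borel_measurable gauss2"
  using measurable_compose[OF rot_measurable H] unfolding measurable_cong_sets[OF sets_gauss2 refl] .

text \<open>Rotating by an additional independent angle turns the correlation of \<open>H\<close> with its rotations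
  into a square of the circle averages of \<open>H\<close>.\<close>

lemma integral_correlation_nonneg:
  "0 \<le> (LINT q|kac_space. w (fst q) * (H (fst q) * H (collide q)))"
proof -
  interpret cc: pair_prob_space circ circ ..
  interpret X: pair_prob_space "circ \<Otimes>\<^sub>M circ" gauss2 ..
  \<comment> \<open>Both copies of \<open>H\<close> are rotated, by independent angles, so that the
    integrand becomes symmetric in the two angles.\<close>
  define Z where "Z a p = w p * (H (rot (cos (fst a)) (sin (fst a)) p) * H (rot (cos (snd a)) (sin (snd a)) p))"
    for a :: "real \<times> real" and p
  let ?S = "LINT p|gauss2. (H p)\<^sup>2"
  have sX: "sets ((circ \<Otimes>\<^sub>M circ) \<Otimes>\<^sub>M gauss2) = sets borel"
  proof -
    have "sets ((circ \<Otimes>\<^sub>M circ) \<Otimes>\<^sub>M gauss2) = sets ((borel \<Otimes>\<^sub>M borel) \<Otimes>\<^sub>M borel)"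
      by (intro sets_pair_measure_cong sets_gauss2 sets_circ)
    then show ?thesis unfolding borel_prod .
  qed
  have Zm: "case_prod Z \<in> borel_measurable ((circ \<Otimes>\<^sub>M circ) \<Otimes>\<^sub>M gauss2)"
    unfolding measurable_cong_sets[OF sX refl] Z_def case_prod_unfold rot_def
    by (intro borel_measurable_times measurable_compose[OF _ w] measurable_compose[OF _ H])
      (intro borel_measurable_continuous_onI continuous_intros)+
  have rotsq: "integrable gauss2 (\<lambda>p. (H (rot (cos t) (sin t) p))\<^sup>2)"
    "(LINT p|gauss2. (H (rot (cos t) (sin t) p))\<^sup>2) = ?S" for t
    using integrable_rot_gauss2_iff[OF H2_measurable, of "cos t" "sin t"] sq
      integral_rot_gauss2[OF H2_measurable, of "cos t" "sin t"] by simp_all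
  have Zi: "integrable gauss2 (Z a)" and Zn: "(LINT p|gauss2. norm (Z a p)) \<le> ?S" for a
  proof -
    let ?D = "\<lambda>p. ((H (rot (cos (fst a)) (sin (fst a)) p))\<^sup>2 + (H (rot (cos (snd a)) (sin (snd a)) p))\<^sup>2) / 2"
    have D: "integrable gauss2 ?D" "(LINT p|gauss2. ?D p) = ?S" using rotsq by simp_all
    have wG: "w \<in> borel_measurable gauss2" using w unfolding measurable_cong_sets[OF sets_gauss2 refl] .
    have le: "norm (Z a p) \<le> ?D p" for p
      unfolding Z_def real_norm_def by (rule weighted_product_le)
    show i: "integrable gauss2 (Z a)"
    proof (rule Bochner_Integration.integrable_bound[OF D(1)])
      show "Z a \<in> borel_measurable gauss2"
        unfolding Z_def[abs_def] by (intro borel_measurable_times wG rot_measurable')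
      show "AE p in gauss2. norm (Z a p) \<le> norm (?D p)"
        by (rule AE_I2) (use le in \<open>auto intro: order_trans[OF _ abs_ge_self]\<close>)
    qed
    have "(LINT p|gauss2. norm (Z a p)) \<le> (LINT p|gauss2. ?D p)"
      by (rule integral_mono[OF integrable_norm[OF i] D(1) le])
    then show "(LINT p|gauss2. norm (Z a p)) \<le> ?S" using D(2) by simp
  qed
  have iZ: "integrable ((circ \<Otimes>\<^sub>M circ) \<Otimes>\<^sub>M gauss2) (case_prod Z)"
  proof (rule X.Fubini_integrable[OF Zm])
    show "integrable (circ \<Otimes>\<^sub>M circ) (\<lambda>a. LINT p|gauss2. norm (case (a, p) of (x, y) \<Rightarrow> Z x y))"
    proof (rule cc.integrable_const_bound[where B = ?S])
      have "(\<lambda>a. LINT p|gauss2. norm (Z a p)) \<in> borel_measurable (circ \<Otimes>\<^sub>M circ)"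
        using measurable_compose[OF Zm borel_measurable_norm]
        by (intro gauss2.P.borel_measurable_lebesgue_integral) (simp add: case_prod_unfold)
      then show "(\<lambda>a. LINT p|gauss2. norm (case (a, p) of (x, y) \<Rightarrow> Z x y)) \<in> borel_measurable (circ \<Otimes>\<^sub>M circ)"
        by simp
    qed (use Zn in simp)
  qed (use Zi in simp)
  \<comment> \<open>The weight is radial and the Gaussian pair is rotation invariant, so one of the
    two rotations can be undone and only the difference of the angles remains.\<close>
  have Zrot: "(LINT p|gauss2. Z a p) = rotation_correlation w H (snd a - fst a)" for a
  proof -
    let ?r = "\<lambda>t. rot (cos t) (sin t)"
    have km: "(\<lambda>p. w p * (H p * H (?r (snd a - fst a) p))) \<in> borel_measurable borel"
      by (intro borel_measurable_times w H measurable_compose[OF rot_measurable H])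
    have "(LINT p|gauss2. w (?r (fst a) p) * (H (?r (fst a) p) * H (?r (snd a - fst a) (?r (fst a) p)))) =
      rotation_correlation w H (snd a - fst a)"
      using integral_rot_gauss2[OF km, of "cos (fst a)" "sin (fst a)"] by (simp add: rotation_correlation_def)
    then show ?thesis by (simp add: rot_rot w_rot Z_def)
  qed
  let ?J = "rotation_correlation w H"
  have Jm: "?J \<in> borel_measurable borel"
    using borel_measurable_integrable[OF integral_correlation(2)] by (simp cong: measurable_cong_sets)
  have iJ: "integrable (circ \<Otimes>\<^sub>M circ) (\<lambda>a. ?J (snd a - fst a))"
    using X.integrable_fst[OF iZ] by (simp add: Zrot)
  \<comment> \<open>Modulo 2 \<pi>, the difference of two independent uniform angles is again
    uniform.\<close>
  have "(LINT a|(circ \<Otimes>\<^sub>M circ). ?J (snd a - fst a)) = (LINT f|circ. LINT t|circ. ?J (t - f))"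
    using cc.integral_fst'[OF iJ] by simp
  also have "\<dots> = (LINT f|circ. LINT t|circ. ?J t)"
  proof (rule integral_cong_AE)
    show "(\<lambda>f. LINT t|circ. ?J (t - f)) \<in> borel_measurable circ"
      using borel_measurable_integrable[OF cc.integrable_fst'[OF iJ]] by simp
    have "AE f in circ. \<bar>f\<bar> \<le> 2 * pi"
      unfolding circ_def by (subst AE_density) (auto split: split_indicator)
    then show "AE f in circ. (LINT t|circ. ?J (t - f)) = (LINT t|circ. ?J t)"
    proof eventually_elim
      case (elim f)
      then show ?case
        using integral_circ_shift(2)[OF Jm rotation_correlation_periodic _ integral_correlation(2), of "- f"] by simp
    qed
  qed simp
  also have "\<dots> = (LINT q|kac_space. w (fst q) * (H (fst q) * H (collide q)))"
    using integral_correlation(1) circ.prob_space by simp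
  finally have "(LINT q|kac_space. w (fst q) * (H (fst q) * H (collide q))) =
    (LINT a|(circ \<Otimes>\<^sub>M circ). LINT p|gauss2. Z a p)" by (simp add: Zrot)
  also have "\<dots> = (LINT p|gauss2. LINT a|(circ \<Otimes>\<^sub>M circ). Z a p)"
    using X.Fubini_integral[OF iZ] by simp
  also have "\<dots> \<ge> 0"
  proof (rule Bochner_Integration.integral_nonneg)
    fix p
    let ?r = "\<lambda>t. H (rot (cos t) (sin t) p)"
    have "0 \<le> (LINT a|(circ \<Otimes>\<^sub>M circ). ?r (fst a) * ?r (snd a))"
    \<comment> \<open>Where the product is integrable, its mean is the square of the circle average.
      Elsewhere the integral is 0 by default, so nonnegativity holds at every p and not merely
      almost everywhere.\<close>
    proof (cases "integrable (circ \<Otimes>\<^sub>M circ) (\<lambda>a. ?r (fst a) * ?r (snd a))")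
      case True
      have "(LINT a|(circ \<Otimes>\<^sub>M circ). ?r (fst a) * ?r (snd a)) = (LINT t|circ. ?r t)\<^sup>2"
        using cc.integral_fst'[OF True] by (simp add: power2_eq_square)
      then show ?thesis by simp
    next
      case False
      then show ?thesis by (simp add: not_integrable_integral_eq)
    qed
    then show "0 \<le> (LINT a|(circ \<Otimes>\<^sub>M circ). Z a p)" using w01 by (simp add: Z_def)
  qed
  finally show ?thesis .
qed

end

text \<open>The sum equals 3/4 + cos(4t)/4, and the oscillating part averages out.\<close>

lemma integral_cos4_circ: "(LINT t|circ. (cos t) ^ 4 + (sin t) ^ 4) = 3 / 4"
  and integrable_cos4_circ: "integrable circ (\<lambda>t. (cos t) ^ 4 + (sin t) ^ 4)"
proof -
  have i: "integrable circ (\<lambda>t. cos (4 * t))"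
    by (rule circ.integrable_const_bound[where B = 1]) auto
  \<comment> \<open>A shift by \<pi>/4 changes the sign of cos(4t) but not its mean, so the mean is
    zero.\<close>
  have "(LINT t|circ. cos (4 * (t + pi / 4))) = (LINT t|circ. cos (4 * t))"
  proof (rule integral_circ_shift(2)[OF _ _ _ i])
    show "cos (4 * (x + 2 * pi)) = cos (4 * x)" for x
      using cos.plus_of_nat[of "4 * x" 4] by (simp add: algebra_simps)
  qed simp_all
  then have z: "(LINT t|circ. cos (4 * t)) = 0"
    by (simp add: distrib_left)
  have eq: "(cos t) ^ 4 + (sin t) ^ 4 = 3 / 4 + cos (4 * t) / 4" for t :: real
  proof -
    have s: "(sin t)\<^sup>2 = 1 - (cos t)\<^sup>2" by (rule sin_squared_eq)
    have "cos (4 * t) = 2 * (2 * (cos t)\<^sup>2 - 1)\<^sup>2 - 1"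
      using cos_double_cos[of "2 * t"] cos_double_cos[of t] by simp
    moreover have "(sin t) ^ 4 = (1 - (cos t)\<^sup>2)\<^sup>2" unfolding s[symmetric] by simp
    moreover have "(cos t) ^ 4 = ((cos t)\<^sup>2)\<^sup>2" by simp
    ultimately show ?thesis
      by (simp only:) (simp add: power2_eq_square field_simps)
  qed
  show "(LINT t|circ. (cos t) ^ 4 + (sin t) ^ 4) = 3 / 4" "integrable circ (\<lambda>t. (cos t) ^ 4 + (sin t) ^ 4)"
    unfolding eq using i z circ.prob_space by simp_all
qed

section \<open>The low-energy cutoff\<close>

definition tent :: "real \<Rightarrow> real \<Rightarrow> real" where
  "tent e x = max 0 (1 - \<bar>x\<bar> / e)"

lemma tent_measurable [measurable]: "tent e \<in> borel_measurable borel"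
  unfolding tent_def[abs_def] by simp

lemma tent_bounds: "0 < e \<Longrightarrow> 0 \<le> tent e x \<and> tent e x \<le> 1"
  by (simp add: tent_def)

text \<open>The peak is 1 / sqrt(2 \<pi>), about 0.399. From \<pi> > 3 alone one gets sqrt(2 \<pi>)
  \<ge> 2.44, and 0.41 times 2.44 exceeds 1.\<close>

lemma std_normal_density_le: "std_normal_density x \<le> 0.41"
proof -
  have "61 / 25 \<le> sqrt (2 * pi)"
    using pi_gt3 by (intro real_le_rsqrt) (simp add: power2_eq_square)
  moreover have "exp (- x\<^sup>2 / 2) \<le> 1" by simp
  ultimately have "exp (- x\<^sup>2 / 2) \<le> 41 / 100 * sqrt (2 * pi)" by linarith
  then show ?thesis
    unfolding std_normal_density_def by (simp add: field_simps)
qed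

text \<open>The tent is a triangle of base 2 e and height 1, hence of area e, integrated against a
  density of at most 0.41.\<close>

lemma integral_tent_gauss_le:
  assumes e: "0 < e"
  shows "(LINT x|gauss. tent e x) \<le> 0.41 * e"
proof -
  have f1: "has_bochner_integral lborel (\<lambda>x. (1 - x / e) * indicator {0..e} x) ((e - e\<^sup>2 / (2 * e)) - (0 - 0\<^sup>2 / (2 * e)))"
    using e by (intro has_bochner_integral_FTC_Icc_nonneg[where F = "\<lambda>x. x - x\<^sup>2 / (2 * e)"])
      (auto intro!: derivative_eq_intros simp: field_simps)
  have f2: "has_bochner_integral lborel (\<lambda>x. (1 + x / e) * indicator {-e..0} x) ((0 + 0\<^sup>2 / (2 * e)) - (- e + (- e)\<^sup>2 / (2 * e)))"
    using e by (intro has_bochner_integral_FTC_Icc_nonneg[where F = "\<lambda>x. x + x\<^sup>2 / (2 * e)"])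
      (auto intro!: derivative_eq_intros simp: field_simps)
  have "has_bochner_integral lborel (\<lambda>x. (1 - x / e) * indicator {0..e} x + (1 + x / e) * indicator {-e..0} x) e"
    using has_bochner_integral_add[OF f1 f2] e by (simp add: power2_eq_square field_simps)
  note I = this[THEN integrable.intros] this[THEN has_bochner_integral_integral_eq]
  \<comment> \<open>The two closed pieces both count the point 0, so there the inequality is
    strict.\<close>
  have le: "tent e x \<le> (1 - x / e) * indicator {0..e} x + (1 + x / e) * indicator {-e..0} x" for x
  proof (cases "\<bar>x\<bar> \<le> e")
    case True
    then have "\<bar>x\<bar> / e \<le> 1" using e by (simp add: pos_divide_le_eq)
    then show ?thesis
      using True by (cases "0 \<le> x") (auto simp: tent_def abs_if split: split_indicator)
  next
    case False
    then have "1 \<le> \<bar>x\<bar> / e" using e by (simp add: pos_le_divide_eq)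
    then show ?thesis using False by (auto simp: tent_def split: split_indicator)
  qed
  have "(LINT x|gauss. tent e x) = (LINT x|lborel. std_normal_density x * tent e x)"
    unfolding gauss_def by (subst integral_density) simp_all
  also have "\<dots> \<le> (LINT x|lborel. 0.41 * ((1 - x / e) * indicator {0..e} x + (1 + x / e) * indicator {-e..0} x))"
  proof (rule integral_mono')
    show "integrable lborel (\<lambda>x. 0.41 * ((1 - x / e) * indicator {0..e} x + (1 + x / e) * indicator {-e..0} x))"
      by (intro integrable_mult_right I(1))
    fix x
    show "std_normal_density x * tent e x \<le> 0.41 * ((1 - x / e) * indicator {0..e} x + (1 + x / e) * indicator {-e..0} x)"
      using tent_bounds[OF e, of x] le[of x] by (intro mult_mono std_normal_density_le) auto
    show "0 \<le> 0.41 * ((1 - x / e) * indicator {0..e} x + (1 + x / e) * indicator {-e..0} x)"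
      using tent_bounds[OF e, of x] le[of x] by simp
  qed
  also have "\<dots> = 0.41 * e" unfolding integral_mult_right_zero I(2) ..
  finally show ?thesis .
qed

section \<open>Correlations of pair sums\<close>

lemma measurable_gauss2I: "k \<in> borel_measurable borel \<Longrightarrow> k \<in> borel_measurable gauss2"
  unfolding measurable_cong_sets[OF sets_gauss2 refl] .

lemma integral_product_gauss2:
  fixes f g :: "real \<Rightarrow> real"
  assumes "f \<in> borel_measurable borel" "g \<in> borel_measurable borel" "integrable gauss f" "integrable gauss g"
  shows "integrable gauss2 (\<lambda>p. f (fst p) * g (snd p))"
    and "(LINT p|gauss2. f (fst p) * g (snd p)) = (LINT x|gauss. f x) * (LINT x|gauss. g x)"
proof -
  have m: "(\<lambda>p. f (fst p) * g (snd p)) \<in> borel_measurable gauss2"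
    using assms(1,2) by (intro borel_measurable_times measurable_compose[OF measurable_fst] measurable_compose[OF measurable_snd]) simp_all
  show i: "integrable gauss2 (\<lambda>p. f (fst p) * g (snd p))"
    by (rule gauss2.Fubini_integrable[OF m]) (use assms in \<open>simp_all add: abs_mult\<close>)
  show "(LINT p|gauss2. f (fst p) * g (snd p)) = (LINT x|gauss. f x) * (LINT x|gauss. g x)"
    using gauss2.integral_fst'[OF i] by simp
qed

lemma snd_borel: "f \<in> borel_measurable borel \<Longrightarrow> (\<lambda>p::real \<times> real. f (snd p)) \<in> borel_measurable borel"
  and fst_borel: "f \<in> borel_measurable borel \<Longrightarrow> (\<lambda>p::real \<times> real. f (fst p)) \<in> borel_measurable borel"
  by (rule measurable_compose; auto intro!: borel_measurable_continuous_onI continuous_intros)+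

lemma integral_snd_gauss2:
  fixes f :: "real \<Rightarrow> real"
  assumes [measurable]: "f \<in> borel_measurable borel"
  shows "(LINT p|gauss2. f (snd p)) = (LINT x|gauss. f x)"
    and "integrable gauss2 (\<lambda>p. f (snd p)) \<longleftrightarrow> integrable gauss f"
  using integral_lin_gauss2[OF assms, of 0 1] by simp_all


lemma pair_sum_square_integrable:
  assumes h: "h \<in> borel_measurable borel" and sq: "integrable gauss (\<lambda>x. (h x)\<^sup>2)"
  shows "integrable gauss2 (\<lambda>p. (pair_sum h p)\<^sup>2)"
    and "(LINT p|gauss2. (pair_sum h p)\<^sup>2) = 2 * (LINT x|gauss. (h x)\<^sup>2) + 2 * (LINT x|gauss. h x)\<^sup>2"
proof -
  have h2m: "(\<lambda>x. (h x)\<^sup>2) \<in> borel_measurable borel" using h by simp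
  have ih: "integrable gauss h"
    using integrable_mult_L2[of h gauss "\<lambda>_. 1"] h sq by simp
  note cross = integral_product_gauss2[OF h h ih ih]
  have eq: "(pair_sum h p)\<^sup>2 = (h (fst p))\<^sup>2 + (h (snd p))\<^sup>2 + 2 * (h (fst p) * h (snd p))" for p
    by (simp add: pair_sum_def power2_sum)
  show "integrable gauss2 (\<lambda>p. (pair_sum h p)\<^sup>2)"
    "(LINT p|gauss2. (pair_sum h p)\<^sup>2) = 2 * (LINT x|gauss. (h x)\<^sup>2) + 2 * (LINT x|gauss. h x)\<^sup>2"
    unfolding eq using integral_fst_gauss2[OF h2m] integral_snd_gauss2[OF h2m] sq cross
    by (simp_all add: power2_eq_square)
qed

lemma
  fixes f :: "real \<Rightarrow> real"
  assumes f: "f \<in> borel_measurable borel"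
  shows integral_gauss_uminus: "(LINT x|gauss. f (- x)) = (LINT x|gauss. f x)"
    and integrable_gauss_uminus: "integrable gauss (\<lambda>x. f (- x)) \<longleftrightarrow> integrable gauss f"
proof -
  have m: "(\<lambda>x. f (- x)) \<in> borel_measurable borel" by (rule measurable_compose[OF _ f]) simp
  show "(LINT x|gauss. f (- x)) = (LINT x|gauss. f x)"
    "integrable gauss (\<lambda>x. f (- x)) \<longleftrightarrow> integrable gauss f"
    using integral_fst_gauss2[OF m] integral_lin_gauss2[OF f, of "-1" 0] by simp_all
qed

text \<open>Of the four products two contain h(v), and a quarter turn brings the two that contain
  h(w) to the same form. The one-particle bound then gives c^4 twice and s^4 twice.\<close>

lemma even_pair_sum_correlation_le:
  fixes h :: "real \<Rightarrow> real"
  assumes h: "h \<in> borel_measurable borel" and even: "\<And>x. h (- x) = h x"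
    and sq: "integrable gauss (\<lambda>x. (h x)\<^sup>2)"
    and h0: "(LINT x|gauss. h x) = 0" and h2: "(LINT x|gauss. x\<^sup>2 * h x) = 0"
    and cs: "c\<^sup>2 + s\<^sup>2 = 1"
  shows "(LINT p|gauss2. pair_sum h p * pair_sum h (rot c s p)) \<le> 2 * (c ^ 4 + s ^ 4) * (LINT x|gauss. (h x)\<^sup>2)"
proof -
  define A where "A a b p = h (fst p) * h (a * fst p + b * snd p)" for a b and p :: "real \<times> real"
  let ?S = "LINT x|gauss. (h x)\<^sup>2"
  have h2m: "(\<lambda>x. (h x)\<^sup>2) \<in> borel_measurable borel" using h by simp
  have linm: "(\<lambda>p. h (a * fst p + b * snd p)) \<in> borel_measurable borel" for a b :: real
    by (rule measurable_compose[OF _ h]) (intro borel_measurable_continuous_onI continuous_intros)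
  have Am: "A a b \<in> borel_measurable borel" for a b
    unfolding A_def[abs_def] by (intro borel_measurable_times fst_borel[OF h] linm)
  have Ai: "integrable gauss2 (A a b)" if "a\<^sup>2 + b\<^sup>2 = 1" for a b
    unfolding A_def[abs_def]
    using integral_fst_gauss2(2)[OF h2m] integral_lin_gauss2(2)[OF h2m that] sq
    by (intro integrable_mult_L2 measurable_gauss2I[OF linm] measurable_gauss2I[OF fst_borel[OF h]]) simp_all
  have Ale: "(LINT p|gauss2. A a b p) \<le> a ^ 4 * ?S" if "a\<^sup>2 + b\<^sup>2 = 1" for a b
    unfolding A_def by (rule even_correlation_le[OF h even sq h0 h2 that])
  have quarter: "(0::real)\<^sup>2 + 1\<^sup>2 = 1" by simp
  have cs': "c\<^sup>2 + (- s)\<^sup>2 = 1" "(- s)\<^sup>2 + c\<^sup>2 = 1" "s\<^sup>2 + (- c)\<^sup>2 = 1"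
    using cs by (simp_all add: add.commute)
  have eq: "pair_sum h p * pair_sum h (rot c s p) = A c s p + A (- s) c p + (A s (- c) (rot 0 1 p) + A c s (rot 0 1 p))" for p
  proof -
    have "h (- c * fst p + s * snd p) = h (c * fst p - s * snd p)"
      using even[of "c * fst p - s * snd p"] by simp
    then show ?thesis by (simp add: pair_sum_def A_def algebra_simps)
  qed
  note r = integrable_rot_gauss2_iff[OF Am quarter] integral_rot_gauss2[OF Am quarter]
  have "(LINT p|gauss2. pair_sum h p * pair_sum h (rot c s p)) =
    (LINT p|gauss2. A c s p) + (LINT p|gauss2. A (- s) c p) + ((LINT p|gauss2. A s (- c) p) + (LINT p|gauss2. A c s p))"
    unfolding eq using Ai[OF cs] Ai[OF cs'(2)] Ai[OF cs'(3)] by (simp add: r)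
  also have "\<dots> \<le> c ^ 4 * ?S + (- s) ^ 4 * ?S + (s ^ 4 * ?S + c ^ 4 * ?S)"
    by (intro add_mono Ale cs cs')
  also have "\<dots> = 2 * (c ^ 4 + s ^ 4) * ?S" by (simp add: algebra_simps)
  finally show ?thesis .
qed

text \<open>Only the even part of \<open>h\<close> contributes, because the angles \<open>\<theta>\<close> and \<open>\<theta> + \<pi>\<close> give opposite
  velocities.\<close>

lemma kac_correlation_le:
  fixes h :: "real \<Rightarrow> real"
  assumes h: "h \<in> borel_measurable borel" and sq: "integrable gauss (\<lambda>x. (h x)\<^sup>2)"
    and h0: "(LINT x|gauss. h x) = 0" and h2: "(LINT x|gauss. x\<^sup>2 * h x) = 0"
  shows "(LINT q|kac_space. pair_sum h (fst q) * pair_sum h (collide q)) \<le> 3 / 2 * (LINT x|gauss. (h x)\<^sup>2)"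
proof -
  define g where "g x = (h x + h (- x)) / 2" for x
  define H where "H = pair_sum h"
  define R where "R t = rot (cos t) (sin t)" for t
  define N where "N = rot (- 1) 0"
  let ?J = "rotation_correlation (\<lambda>_. 1) H" and ?K = "rotation_correlation (\<lambda>_. 1) (pair_sum g)"
  let ?S = "LINT x|gauss. (h x)\<^sup>2" and ?T = "LINT x|gauss. (g x)\<^sup>2"
  have hu: "(\<lambda>x. h (- x)) \<in> borel_measurable borel" by (rule measurable_compose[OF _ h]) simp
  have gm: "g \<in> borel_measurable borel" unfolding g_def[abs_def] using h hu by simp
  have h2m: "(\<lambda>x. (h x)\<^sup>2) \<in> borel_measurable borel" and xh: "(\<lambda>x. x\<^sup>2 * h x) \<in> borel_measurable borel"
    using h by simp_all
  have ih: "integrable gauss h"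
    using integrable_mult_L2[of h gauss "\<lambda>_. 1"] h sq by simp
  have ixh: "integrable gauss (\<lambda>x. x\<^sup>2 * h x)"
    using integrable_mult_L2[of "\<lambda>x. x\<^sup>2" gauss h] h sq by (simp flip: power_mult)
  have gle: "(g x)\<^sup>2 \<le> ((h x)\<^sup>2 + (h (- x))\<^sup>2) / 2" for x
    using add_power2_le[of "h x" "h (- x)"] by (simp add: g_def power_divide)
  have iD: "integrable gauss (\<lambda>x. ((h x)\<^sup>2 + (h (- x))\<^sup>2) / 2)"
    and ID: "(LINT x|gauss. ((h x)\<^sup>2 + (h (- x))\<^sup>2) / 2) = ?S"
    using sq integrable_gauss_uminus[OF h2m] integral_gauss_uminus[OF h2m] by simp_all
  have gsq: "integrable gauss (\<lambda>x. (g x)\<^sup>2)"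
    by (rule Bochner_Integration.integrable_bound[OF iD]) (use gm gle in auto)
  have TS: "?T \<le> ?S" using integral_mono[OF gsq iD gle] ID by simp
  have g_even: "g (- x) = g x" for x by (simp add: g_def)
  have g0: "(LINT x|gauss. g x) = 0"
    unfolding g_def using ih h0 integrable_gauss_uminus[OF h] integral_gauss_uminus[OF h] by simp
  have xg: "x\<^sup>2 * g x = (x\<^sup>2 * h x + (- x)\<^sup>2 * h (- x)) / 2" for x by (simp add: g_def algebra_simps)
  have g2: "(LINT x|gauss. x\<^sup>2 * g x) = 0"
    unfolding xg using ixh h2 integrable_gauss_uminus[OF xh] integral_gauss_uminus[OF xh] by simp
  have Hm: "H \<in> borel_measurable borel" unfolding H_def by (rule pair_sum_measurable[OF h])
  have H2m: "(\<lambda>p. (H p)\<^sup>2) \<in> borel_measurable borel" using Hm by simp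
  have H2: "integrable gauss2 (\<lambda>p. (H p)\<^sup>2)"
    unfolding H_def by (rule pair_sum_square_integrable(1)[OF h sq])
  have Hr: "(\<lambda>p. H (rot c s p)) \<in> borel_measurable gauss2" for c s
    by (rule measurable_gauss2I[OF measurable_compose[OF rot_measurable Hm]])
  have Hrsq: "integrable gauss2 (\<lambda>p. (H (rot c s p))\<^sup>2)" if "c\<^sup>2 + s\<^sup>2 = 1" for c s
    using integrable_rot_gauss2_iff[OF H2m that] H2 by simp
  have i: "integrable gauss2 (\<lambda>p. H (rot a b p) * H (rot c s p))"
    if "a\<^sup>2 + b\<^sup>2 = 1" "c\<^sup>2 + s\<^sup>2 = 1" for a b c s
    by (rule integrable_mult_L2[OF Hr Hr Hrsq[OF that(1)] Hrsq[OF that(2)]])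
  have id: "rot 1 0 p = p" for p by (simp add: rot_def)
  have NR: "N (R t p) = rot (- cos t) (- sin t) p" for t p by (simp add: N_def R_def rot_def)
  have shift: "rot (cos (t + pi)) (sin (t + pi)) p = N (R t p)" for t p by (simp add: NR)
  \<comment> \<open>With \<open>N\<close> the half turn p \<mapsto> -p, the pair sum of the even
    part is the mean of \<open>H\<close> and its composition with \<open>N\<close>. Expanding gives
    four correlations, equal in pairs because \<open>N\<close> preserves the Gaussian pair and
    commutes with rotations.\<close>
  have K: "?K t = (?J t + ?J (t + pi)) / 2" for t
  proof -
    have m: "(\<lambda>p. H p * H (rot c s p)) \<in> borel_measurable borel" for c s
      by (intro borel_measurable_times Hm measurable_compose[OF rot_measurable Hm])
    have n1: "(- 1)\<^sup>2 + 0\<^sup>2 = (1::real)" by simp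
    have RN: "R t (N p) = N (R t p)" and NN: "N (N p) = p" for p
      by (simp_all add: N_def R_def rot_def)
    have J1: "?J t = (LINT p|gauss2. H p * H (R t p))"
      by (simp add: rotation_correlation_def R_def)
    have J2: "?J t = (LINT p|gauss2. H (N p) * H (N (R t p)))"
      using integral_rot_gauss2[OF m n1, of "cos t" "sin t", folded N_def R_def] unfolding J1 RN by simp
    have J3: "?J (t + pi) = (LINT p|gauss2. H p * H (N (R t p)))"
      by (simp add: rotation_correlation_def shift del: cos_periodic_pi sin_periodic_pi)
    have J4: "?J (t + pi) = (LINT p|gauss2. H (N p) * H (R t p))"
      using integral_rot_gauss2[OF m n1, of "- cos t" "- sin t", folded N_def NR] unfolding J3 RN NN by simp
    have gH: "pair_sum g p = (H p + H (N p)) / 2" for p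
      by (simp add: pair_sum_def g_def H_def N_def rot_def add_divide_distrib)
    have csn: "(cos t)\<^sup>2 + (sin t)\<^sup>2 = 1" "(- cos t)\<^sup>2 + (- sin t)\<^sup>2 = 1" "1\<^sup>2 + 0\<^sup>2 = (1::real)" by simp_all
    have ints: "integrable gauss2 (\<lambda>p. H p * H (R t p))" "integrable gauss2 (\<lambda>p. H (N p) * H (N (R t p)))"
      "integrable gauss2 (\<lambda>p. H p * H (N (R t p)))" "integrable gauss2 (\<lambda>p. H (N p) * H (R t p))"
      using i[OF csn(3) csn(1)] i[OF n1 csn(2)] i[OF csn(3) csn(2)] i[OF n1 csn(1)]
      unfolding NR unfolding N_def R_def id .
    have "?K t = (LINT p|gauss2. (H p + H (N p)) / 2 * ((H (R t p) + H (N (R t p))) / 2))"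
      unfolding rotation_correlation_def gH by (simp add: R_def)
    also have "\<dots> = (LINT p|gauss2. (H p * H (R t p) + H (N p) * H (N (R t p)) + (H p * H (N (R t p)) + H (N p) * H (R t p))) / 4)"
      by (simp add: algebra_simps)
    also have "\<dots> = (?J t + ?J t + (?J (t + pi) + ?J (t + pi))) / 4"
      using ints by (subst (2) J2, subst J1, subst (2) J4, subst J3) simp
    finally show ?thesis by simp
  qed
  note corr = integral_correlation[of "\<lambda>_. 1" H, OF _ Hm _ _ _ H2, simplified]
  have Jm: "?J \<in> borel_measurable borel"
    using borel_measurable_integrable[OF corr(2)] by (simp cong: measurable_cong_sets)
  have pi2: "\<bar>pi\<bar> \<le> 2 * pi" by simp
  note sh = integral_circ_shift[OF Jm rotation_correlation_periodic pi2 corr(2)]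
  have Kle: "?K t \<le> 2 * ((cos t) ^ 4 + (sin t) ^ 4) * ?T" for t
    unfolding rotation_correlation_def
    using even_pair_sum_correlation_le[OF gm g_even gsq g0 g2, of "cos t" "sin t"] by simp
  have Ki: "integrable circ ?K" unfolding K[abs_def] using corr(2) sh(1) by simp
  have "(LINT q|kac_space. H (fst q) * H (collide q)) = (LINT t|circ. ?J t)" by (rule corr(1))
  \<comment> \<open>Translating the uniform angle by \<pi> does not change the mean, so passing to
    the even part costs nothing here.\<close>
  also have "\<dots> = (LINT t|circ. ?K t)" unfolding K using corr(2) sh by simp
  also have "\<dots> \<le> (LINT t|circ. 2 * ((cos t) ^ 4 + (sin t) ^ 4) * ?T)"
    by (intro integral_mono Ki Kle integrable_mult_left integrable_mult_right integrable_cos4_circ)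
  also have "\<dots> = 3 / 2 * ?T"
    unfolding integral_mult_left_zero integral_mult_right_zero integral_cos4_circ by simp
  finally show ?thesis using TS by (simp add: H_def)
qed

text \<open>The factor 3.28 is 2 times 4 times 0.41: the 2 is the cost of the weighted jump, the 4
  comes from splitting H^2 into two one-particle terms with coefficient 2 each, and 0.41 e bounds
  the mean of the tent. The left side is twice the bound for the gap, since the right side is twice
  the negative of the form.\<close>

lemma kac_dissipation_ge:
  fixes h :: "real \<Rightarrow> real"
  assumes h: "h \<in> borel_measurable borel" and sq: "integrable gauss (\<lambda>x. (h x)\<^sup>2)"
    and h0: "(LINT x|gauss. h x) = 0" and h2: "(LINT x|gauss. x\<^sup>2 * h x) = 0"
    and D: "integrable kac_space (\<lambda>q. ((fst (fst q))\<^sup>2 + (snd (fst q))\<^sup>2) powr (1 / 2) * (pair_sum h (collide q) - pair_sum h (fst q))\<^sup>2)"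
    and e: "0 < e"
  shows "e * (1 - 3.28 * e) * (LINT x|gauss. (h x)\<^sup>2) \<le>
    (LINT q|kac_space. ((fst (fst q))\<^sup>2 + (snd (fst q))\<^sup>2) powr (1 / 2) * (pair_sum h (collide q) - pair_sum h (fst q))\<^sup>2)"
proof -
  define S where "S = (LINT x|gauss. (h x)\<^sup>2)"
  define r where "r p = ((fst p)\<^sup>2 + (snd p)\<^sup>2) powr (1 / 2)" for p :: "real \<times> real"
  define w where "w p = tent e (r p)" for p
  define H where "H = pair_sum h"
  let ?d = "\<lambda>q. (H (collide q) - H (fst q))\<^sup>2"
  have r_sqrt: "r p = sqrt ((fst p)\<^sup>2 + (snd p)\<^sup>2)" for p
    by (simp add: r_def powr_half_sqrt)
  have Hm: "H \<in> borel_measurable borel" unfolding H_def by (rule pair_sum_measurable[OF h])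
  have H2m: "(\<lambda>p. (H p)\<^sup>2) \<in> borel_measurable borel" using Hm by simp
  have rm: "r \<in> borel_measurable borel"
    unfolding r_sqrt[abs_def] by (intro borel_measurable_continuous_onI continuous_intros)
  have wm: "w \<in> borel_measurable borel"
    unfolding w_def[abs_def] by (rule measurable_compose[OF rm tent_measurable])
  have w01: "0 \<le> w p" "w p \<le> 1" for p using tent_bounds[OF e] by (simp_all add: w_def)
  have w_rot: "w (rot c s p) = w p" if "c\<^sup>2 + s\<^sup>2 = 1" for c s p
    unfolding w_def r_def rot_norm[OF that] ..
  have h2m: "(\<lambda>x. (h x)\<^sup>2) \<in> borel_measurable borel" using h by simp
  have H2: "integrable gauss2 (\<lambda>p. (H p)\<^sup>2)" "(LINT p|gauss2. (H p)\<^sup>2) = 2 * S"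
    using pair_sum_square_integrable[OF h sq] h0 by (simp_all add: H_def S_def)
  have iHH: "integrable kac_space (\<lambda>q. H (fst q) * H (collide q))"
    using integrable_correlation[of "\<lambda>_. 1" H] Hm H2(1) by simp
  have iH1: "integrable kac_space (\<lambda>q. (H (fst q))\<^sup>2)" "(LINT q|kac_space. (H (fst q))\<^sup>2) = 2 * S"
    using integrable_fst_kac[OF H2m] integral_fst_kac[OF H2m] H2 by simp_all
  have iH2: "integrable kac_space (\<lambda>q. (H (collide q))\<^sup>2)" "(LINT q|kac_space. (H (collide q))\<^sup>2) = 2 * S"
    using integrable_collide[OF H2m] integral_collide[OF H2m] H2 by simp_all
  have deq: "?d q = (H (collide q))\<^sup>2 + (H (fst q))\<^sup>2 - 2 * (H (fst q) * H (collide q))" for q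
    by (simp add: power2_diff)
  have d: "integrable kac_space ?d" and dS: "S \<le> (LINT q|kac_space. ?d q)"
  proof -
    show "integrable kac_space ?d" unfolding deq using iH1 iH2 iHH by simp
    have "(LINT q|kac_space. ?d q) = 2 * S + 2 * S - 2 * (LINT q|kac_space. H (fst q) * H (collide q))"
      unfolding deq using iH1 iH2 iHH by simp
    moreover have "(LINT q|kac_space. H (fst q) * H (collide q)) \<le> 3 / 2 * S"
      unfolding H_def S_def by (rule kac_correlation_le[OF h sq h0 h2])
    ultimately show "S \<le> (LINT q|kac_space. ?d q)" by linarith
  qed
  have wH2m: "(\<lambda>p. w p * (H p)\<^sup>2) \<in> borel_measurable borel" using wm Hm by simp
  have wb: "integrable M (\<lambda>x. w (g x) * f x)"
    if "integrable M f" "(\<lambda>x. w (g x)) \<in> borel_measurable M" for M f and g :: "'a \<Rightarrow> real \<times> real"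
    by (rule Bochner_Integration.integrable_bound[OF that(1)])
      (use that w01 in \<open>simp_all add: abs_mult mult_left_le_one_le\<close>)
  have wf: "(\<lambda>q. w (fst q)) \<in> borel_measurable kac_space"
    unfolding borel_measurable_kac_space by (rule fst_kac_measurable[OF wm])
  have wid: "(\<lambda>p. w p) \<in> borel_measurable gauss2" by (rule measurable_gauss2I[OF wm])
  have wd: "integrable kac_space (\<lambda>q. w (fst q) * ?d q)" by (rule wb[OF d wf])
  have wdle: "(LINT q|kac_space. w (fst q) * ?d q) \<le> 2 * (LINT p|gauss2. w p * (H p)\<^sup>2)"
  proof -
    have i: "integrable gauss2 (\<lambda>p. w p * (H p)\<^sup>2)" by (rule wb[OF H2(1) wid])
    have wc: "w (collide q) = w (fst q)" for q
      unfolding collide_def by (rule w_rot) simp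
    have eq: "w (fst q) * ?d q = w (collide q) * (H (collide q))\<^sup>2 + w (fst q) * (H (fst q))\<^sup>2 - 2 * (w (fst q) * (H (fst q) * H (collide q)))" for q
      unfolding deq wc by (simp add: algebra_simps)
    have "0 \<le> (LINT q|kac_space. w (fst q) * (H (fst q) * H (collide q)))"
      by (rule integral_correlation_nonneg[OF wm Hm w01 _ H2(1)]) (rule w_rot)
    moreover have "(LINT q|kac_space. w (fst q) * ?d q) = 2 * (LINT p|gauss2. w p * (H p)\<^sup>2) - 2 * (LINT q|kac_space. w (fst q) * (H (fst q) * H (collide q)))"
      unfolding eq
      using integrable_collide[OF wH2m] integral_collide[OF wH2m] integrable_fst_kac[OF wH2m] integral_fst_kac[OF wH2m]
        i integrable_correlation[OF wm Hm w01 _ H2(1)] w_rot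
      by simp
    ultimately show ?thesis by linarith
  qed
  have wHle: "(LINT p|gauss2. w p * (H p)\<^sup>2) \<le> 4 * (0.41 * e * S)"
  proof -
    let ?t = "tent e"
    have tm: "?t \<in> borel_measurable borel" by (rule tent_measurable)
    have ti: "integrable gauss ?t"
      by (rule gauss.integrable_const_bound[where B = 1]) (use tent_bounds[OF e] in auto)
    have tint: "(LINT x|gauss. ?t x) * S \<le> 0.41 * e * S"
      by (intro mult_right_mono integral_tent_gauss_le[OF e]) (simp add: S_def)
    note p1 = integral_product_gauss2[OF h2m tm sq ti]
    note p2 = integral_product_gauss2[OF tm h2m ti sq]
    have anti: "?t x \<le> ?t y" if "y \<le> x" "0 \<le> y" for x y
      using that e by (simp add: tent_def divide_right_mono max_def)
    \<comment> \<open>The radius dominates each coordinate, so the weight may be replaced by a tent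
      in the coordinate that h does not see; the expectation then factorizes by
      independence.\<close>
    have le1: "w p \<le> ?t (snd p)" and le2: "w p \<le> ?t (fst p)" for p
    proof -
      have "\<bar>snd p\<bar> \<le> r p" "\<bar>fst p\<bar> \<le> r p" unfolding r_sqrt by (simp_all add: real_le_rsqrt)
      from anti[OF this(1)] anti[OF this(2)] show "w p \<le> ?t (snd p)" "w p \<le> ?t (fst p)"
        by (simp_all add: w_def) (simp_all add: tent_def)
    qed
    have "(LINT p|gauss2. w p * (H p)\<^sup>2) \<le> (LINT p|gauss2. 2 * ((h (fst p))\<^sup>2 * ?t (snd p)) + 2 * (?t (fst p) * (h (snd p))\<^sup>2))"
    proof (rule integral_mono[OF wb[OF H2(1) wid]])
      show "integrable gauss2 (\<lambda>p. 2 * ((h (fst p))\<^sup>2 * ?t (snd p)) + 2 * (?t (fst p) * (h (snd p))\<^sup>2))"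
        using p1(1) p2(1) by simp
      fix p
      have "w p * (H p)\<^sup>2 \<le> w p * (2 * (h (fst p))\<^sup>2 + 2 * (h (snd p))\<^sup>2)"
        using w01 add_power2_le by (intro mult_left_mono) (auto simp: H_def pair_sum_def)
      also have "\<dots> = 2 * ((h (fst p))\<^sup>2 * w p) + 2 * (w p * (h (snd p))\<^sup>2)" by (simp add: algebra_simps)
      also have "\<dots> \<le> 2 * ((h (fst p))\<^sup>2 * ?t (snd p)) + 2 * (?t (fst p) * (h (snd p))\<^sup>2)"
        by (intro add_mono mult_left_mono mult_right_mono le1 le2) simp_all
      finally show "w p * (H p)\<^sup>2 \<le> 2 * ((h (fst p))\<^sup>2 * ?t (snd p)) + 2 * (?t (fst p) * (h (snd p))\<^sup>2)" .
    qed
    also have "\<dots> = 4 * ((LINT x|gauss. ?t x) * S)"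
      using p1 p2 by (simp add: S_def)
    finally show ?thesis using tint by linarith
  qed
  have "e * (1 - 3.28 * e) * S = e * (S - 2 * (4 * (0.41 * e * S)))" by (simp add: algebra_simps)
  also have "\<dots> \<le> e * (LINT q|kac_space. ?d q - w (fst q) * ?d q)"
    using d wd dS wdle wHle e by (intro mult_left_mono) simp_all
  also have "\<dots> = (LINT q|kac_space. e * (?d q - w (fst q) * ?d q))" by simp
  also have "\<dots> \<le> (LINT q|kac_space. r (fst q) * ?d q)"
  proof (rule integral_mono)
    show "integrable kac_space (\<lambda>q. e * (?d q - w (fst q) * ?d q))" using d wd by simp
    show "integrable kac_space (\<lambda>q. r (fst q) * ?d q)" using D by (simp add: r_def H_def)
    fix q :: "(real \<times> real) \<times> real"
    have "0 \<le> r (fst q)" by (simp add: r_def)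
    then have "1 - w (fst q) \<le> r (fst q) / e" by (simp add: w_def tent_def)
    then have "e * (1 - w (fst q)) \<le> r (fst q)" using e by (simp add: pos_le_divide_eq mult.commute)
    then have "e * (1 - w (fst q)) * ?d q \<le> r (fst q) * ?d q" by (rule mult_right_mono) simp
    then show "e * (?d q - w (fst q) * ?d q) \<le> r (fst q) * ?d q" by (simp add: algebra_simps)
  qed
  finally show ?thesis by (simp add: S_def r_def H_def)
qed

theorem theorem1p6: "kac_gap (1/2) \<ge> ereal 0.0263"
  unfolding kac_gap_def
proof (rule INF_greatest)
  fix h assume "h \<in> kac_admissible (1 / 2)"
  then have h: "h \<in> borel_measurable borel" and L2: "integrable lborel (\<lambda>v. (h v)\<^sup>2 * Maxw v)"
    and nz: "\<not> (AE v in lborel. h v = 0)" and conv: "kac_form_converges (1 / 2) h"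
    and m0: "(LINT v|lborel. h v * Maxw v) = 0" and m2: "(LINT v|lborel. v\<^sup>2 * h v * Maxw v) = 0"
    by (simp_all add: kac_admissible_def L2M_def)
  have gauss_lborel: "(LINT x|gauss. f x) = (LINT x|lborel. f x * Maxw x)"
    "integrable gauss f \<longleftrightarrow> integrable lborel (\<lambda>x. f x * Maxw x)"
    if "f \<in> borel_measurable borel" for f
    unfolding gauss_def using that
    by (simp_all add: integral_density integrable_density mult.commute)
  define S where "S = (LINT x|gauss. (h x)\<^sup>2)"
  have sq: "integrable gauss (\<lambda>x. (h x)\<^sup>2)" using L2 h by (simp add: gauss_lborel)
  have h0: "(LINT x|gauss. h x) = 0" using m0 h by (simp add: gauss_lborel)
  have h2: "(LINT x|gauss. x\<^sup>2 * h x) = 0" using m2 h by (simp add: gauss_lborel)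
  have norm: "(L2M_norm h)\<^sup>2 = S"
    using h by (simp add: L2M_norm_def S_def gauss_lborel)
  have S: "0 < S"
  proof -
    have "S \<noteq> 0"
    proof
      assume "S = 0"
      then have "AE x in lborel. (h x)\<^sup>2 * Maxw x = 0"
        using L2 h by (subst integral_nonneg_eq_0_iff_AE[symmetric]) (simp_all add: S_def gauss_lborel)
      then have "AE x in lborel. h x = 0"
        by eventually_elim (simp add: normal_density_def)
      with nz show False ..
    qed
    moreover have "0 \<le> S" by (simp add: S_def)
    ultimately show ?thesis by simp
  qed
  define w where "w p = ((fst p)\<^sup>2 + (snd p)\<^sup>2) powr (1 / 2)" for p :: "real \<times> real"
  have wm: "w \<in> borel_measurable borel"
    unfolding w_def[abs_def] by (intro powr_real_measurable borel_measurable_const borel_measurable_continuous_onI continuous_intros)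
  have w_rot: "w (rot c s p) = w p" if "c\<^sup>2 + s\<^sup>2 = 1" for c s p
    unfolding w_def rot_norm[OF that] ..
  have w_swap: "w (snd p, fst p) = w p" for p by (simp add: w_def add.commute)
  note form = kac_form_kac_space[OF h, of "1 / 2"]
  have a: "integrable kac_space (\<lambda>q. w (fst q) * h (fst (fst q)) * (pair_sum h (collide q) - pair_sum h (fst q)))"
    using form(1) conv by (simp add: w_def)
  have sym: "integrable kac_space (\<lambda>q. w (fst q) * (pair_sum h (collide q) - pair_sum h (fst q))\<^sup>2)"
    "(LINT q|kac_space. w (fst q) * (pair_sum h (collide q) - pair_sum h (fst q))\<^sup>2) =
      - 4 * (LINT q|kac_space. w (fst q) * h (fst (fst q)) * (pair_sum h (collide q) - pair_sum h (fst q)))"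
    by (rule kac_space_symmetrization[OF h wm _ w_swap a], erule w_rot)+
  \<comment> \<open>The maximizer of e (1 - 3.28 e) is 1 / 6.56, about 0.152. At 0.15 the value is
    0.0762, half of which, 0.0381, exceeds 0.0263.\<close>
  have "0.15 * (1 - 3.28 * 0.15) * S \<le> (LINT q|kac_space. w (fst q) * (pair_sum h (collide q) - pair_sum h (fst q))\<^sup>2)"
    unfolding S_def w_def
    by (rule kac_dissipation_ge[OF h sq h0 h2]) (use sym(1) in \<open>simp_all add: w_def\<close>)
  \<comment> \<open>The symmetrized square is -4 times, and the form 2 times, the same
    expectation.\<close>
  also have "\<dots> = - 2 * kac_form (1 / 2) h"
    using sym(2) form(2) by (simp add: w_def)
  finally have "0.0263 * S \<le> - kac_form (1 / 2) h" using S by simp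
  then have "0.0263 \<le> - kac_form (1 / 2) h / S" by (subst pos_le_divide_eq[OF S])
  then show "ereal 0.0263 \<le> ereal (- kac_form (1 / 2) h / (L2M_norm h)\<^sup>2)"
    unfolding norm by simp
qed

end
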